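(* Let $k\geq 1$ be a fixed integer. For any complex number $m\in\mathbf{C}$ with $\mathrm{Re}(m)\geq 0$, there exists a complex number $\mu_k(m)$ such that $$\lim_{h\to+\infty}\frac{1}{h^k}\sum_{\substack{|\mathbf{h}|\leq h\\ h_i\text{ distinct}}}\mathfrak{S}(\mathbf{h})^m=\mu_k(m),$$ where the sum is over $k$-tuples $\mathbf{h}=(h_1,\ldots,h_k)$ of pairwise distinct integers with $1\leq h_i\leq h$ for all $i$. Moreover, for $m,k\geq 1$ both integers, we have the symmetry property $$\mu_k(m)=\mu_m(k);$$ in addition, $\mu_1(m)=1$ for all integers $m\geq 1$, and hence $\mu_k(1)=1$ for all integers $k\geq 1$.
   Context: For a $k$-tuple $\mathbf{h}=(h_1,\ldots,h_k)$ of distinct positive integers, put $|\mathbf{h}|=\max_i h_i$. For a prime $p$, let $\nu_p(\mathbf{h})$ be the cardinality of the set of reductions $\{h_1,\ldots,h_k\}$ modulo $p$. The singular series of $\mathbf{h}$ is the absolutely convergent Euler product over primes $$\mathfrak{S}(\mathbf{h})=\prod_p\Bigl(1-\frac{\nu_p(\mathbf{h})}{p}\Bigr)\Bigl(1-\frac1p\Bigr)^{-k}\geq 0.$$ For complex exponents $m$ with $\mathrm{Re}(m)\geq 0$, powers of nonnegative reals are taken with the principal (real logarithm) definition for positive base, and with the convention $0^m=0$ (also when $\mathrm{Re}(m)=0$). *)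

theory Defs
  imports "HOL-Analysis.Analysis" "HOL-Computational_Algebra.Primes"
begin

text \<open>A tuple $(h_1, \ldots, h_k)$ is represented as a list of length $k$.\<close>

definition residue_count :: "nat \<Rightarrow> nat list \<Rightarrow> nat" where
  "residue_count p hs = card ((\<lambda>a. a mod p) ` set hs)"

definition euler_factor :: "nat list \<Rightarrow> nat \<Rightarrow> real" where
  "euler_factor hs p =
     (1 - real (residue_count p hs) / real p) * (1 - 1 / real p) powi (- int (length hs))"

text \<open>The Euler product is a product over all naturals with factor 1 at the non-primes.
  A vanishing factor (\<open>residue_count p hs = p\<close>) makes the product \<open>0\<close>: the library's
  notion of convergence tolerates finitely many zero factors.\<close>

definition singular_series :: "nat list \<Rightarrow> real" where
  "singular_series hs = (\<Prod>p. if prime p then euler_factor hs p else 1)"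

definition distinct_tuples :: "nat \<Rightarrow> nat \<Rightarrow> nat list set" where
  "distinct_tuples k h = {hs. length hs = k \<and> distinct hs \<and> set hs \<subseteq> {1..h}}"

text \<open>The convention $0^m = 0$ for all $m$, including $\mathrm{Re}(m) = 0$, is the one of
  complex \<open>powr\<close>; at a positive real base, \<open>powr\<close> uses the real logarithm.\<close>

definition singular_series_mean :: "nat \<Rightarrow> complex \<Rightarrow> nat \<Rightarrow> complex" where
  "singular_series_mean k m h =
     1 / of_nat h ^ k * (\<Sum>hs\<in>distinct_tuples k h. complex_of_real (singular_series hs) powr m)"

end

theory Submission
  imports Defs "HOL-Number_Theory.Cong"
begin

text \<open>The partial Euler product \<open>S\<^sub>Q\<close> over primes \<open>p \<le> Q\<close> depends only on the tuple modulo the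
  primorial, so the mean of \<open>S\<^sub>Q powr m\<close> converges to a local mean over residues. The factor at \<open>p\<close> is
  \<open>1 + O(1 / p\<^sup>2)\<close> unless \<open>p\<close> divides some difference \<open>h\<^sub>i - h\<^sub>j\<close>, when it is \<open>1 + O(1 / p)\<close>. Hence replacing the
  singular series by \<open>S\<^sub>Q\<close> is controlled by \<open>\<Sum>1 / p\<close> over the primes \<open>p > Q\<close> dividing a difference, whose
  second moment is \<open>O(1 / Q)\<close>, while the full sum over \<open>p\<close> has bounded exponential moments. The error
  \<open>O(1 / sqrt Q)\<close> is uniform in \<open>h\<close>, so the two limits can be interchanged. For integral \<open>m\<close>,
  \<open>(1 - \<nu> p / p) ^ m\<close> is the probability that \<open>m\<close> random residues avoid \<open>h\<^sub>1, \<dots>, h\<^sub>k\<close> modulo \<open>p\<close>, which makes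
  the local mean visibly symmetric in \<open>k\<close> and \<open>m\<close>.\<close>

section \<open>Sums of reciprocals of prime divisors\<close>

definition prime_recip_sum :: "nat \<Rightarrow> nat \<Rightarrow> real" where
  "prime_recip_sum Q d = (\<Sum>p | prime p \<and> p dvd d \<and> Q < p. 1 / real p)"

lemma finite_primes_dvd: "d > 0 \<Longrightarrow> finite {p::nat. prime p \<and> p dvd d \<and> Q < p}"
  by (rule finite_subset[OF _ finite_divisors_nat[of d]]) auto

lemma prime_recip_sum_nonneg: "prime_recip_sum Q d \<ge> 0"
  unfolding prime_recip_sum_def by (rule sum_nonneg) auto

lemma prime_recip_sum_antimono:
  assumes "d > 0" "Q \<le> R"
  shows "prime_recip_sum R d \<le> prime_recip_sum Q d"
  unfolding prime_recip_sum_def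
  using assms by (intro sum_mono2 finite_primes_dvd) auto

text \<open>Telescoping, since \<open>1 / (n + 1)^2 \<le> 1 / n - 1 / (n + 1)\<close>.\<close>

lemma sum_inverse_squares_Ioc_le:
  assumes "Q \<ge> 1"
  shows "(\<Sum>n\<in>{Q<..N}. 1 / real n ^ 2) \<le> 1 / real Q"
proof (cases "Q \<le> N")
  case True
  have "(\<Sum>n\<in>{Q<..N}. 1 / real n ^ 2) \<le> 1 / real Q - 1 / real N"
    using True
  proof (induction N rule: dec_induct)
    case (step n)
    have "{Q<..Suc n} = insert (Suc n) {Q<..n}" using step by auto
    hence "(\<Sum>n\<in>{Q<..Suc n}. 1 / real n ^ 2)
        \<le> 1 / real (Suc n) ^ 2 + (1 / real Q - 1 / real n)" using step by simp
    moreover have "1 / real (Suc n) ^ 2 \<le> 1 / real n - 1 / real (Suc n)"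
    proof -
      have n: "real n > 0" using step assms by auto
      have "1 / real (Suc n) ^ 2 \<le> 1 / (real n * real (Suc n))"
        using n by (intro divide_left_mono) (auto simp: power2_eq_square mult_right_mono)
      also have "\<dots> = 1 / real n - 1 / real (Suc n)" using n by (simp add: field_simps)
      finally show ?thesis .
    qed
    ultimately show ?case by linarith
  qed simp
  thus ?thesis by (smt (verit) divide_nonneg_nonneg of_nat_0_le_iff)
qed simp

lemma sum_inverse_squares_le: "(\<Sum>n=1..N. 1 / real n ^ 2) \<le> 2"
proof (cases "N = 0")
  case False
  hence "{1..N} = insert 1 {1<..N}" by auto
  thus ?thesis using sum_inverse_squares_Ioc_le[of 1 N] by simp
qed simp

lemma sum_multiples:
  fixes G :: "nat \<Rightarrow> real"
  assumes "q > 0"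
  shows "(\<Sum>d | d \<in> {1..n} \<and> q dvd d. G d) = (\<Sum>e=1..n div q. G (q * e))"
proof (rule sum.reindex_bij_betw[symmetric])
  show "bij_betw (\<lambda>e. q * e) {1..n div q} {d. d \<in> {1..n} \<and> q dvd d}"
    by (rule bij_betw_byWitness[where f' = "\<lambda>d. d div q"])
       (use assms in \<open>auto simp: div_le_mono less_eq_div_iff_mult_less_eq mult.commute elim!: dvdE\<close>)
qed

text \<open>Induction on the set of primes. A new prime \<open>q\<close> changes the weight only on
  multiples of \<open>q\<close>, by the factor \<open>1 + g / q\<close>, and the old weight of
  \<open>q * e\<close> is that of \<open>e\<close> because \<open>q\<close> is not in
  \<open>A\<close>. The multiples form a fraction at most \<open>1 / q\<close> of the range, so the
  bound gains the factor \<open>1 + g / q^2\<close>. The range must vary in the induction, as the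
  hypothesis is also applied to \<open>n div q\<close>.\<close>

lemma sum_prod_dvd_le:
  fixes g :: real
  assumes "finite A" "\<And>p. p \<in> A \<Longrightarrow> prime p" "g \<ge> 0"
  shows "(\<Sum>d=1..n. \<Prod>p | p \<in> A \<and> p dvd d. 1 + g / real p)
       \<le> real n * (\<Prod>p\<in>A. 1 + g / real p ^ 2)"
  using assms(1,2)
proof (induction A arbitrary: n rule: finite_induct)
  case (insert q A)
  have q: "prime q" "q > 0" using insert.prems prime_gt_0_nat by auto
  define F where "F = (\<lambda>d. \<Prod>p | p \<in> A \<and> p dvd d. 1 + g / real p)"
  define R where "R = (\<Prod>p\<in>A. 1 + g / real p ^ 2)"
  have IH: "(\<Sum>d=1..n. F d) \<le> real n * R" for n
    unfolding F_def R_def using insert by auto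
  have R0: "R \<ge> 0" unfolding R_def using assms(3) by (intro prod_nonneg) auto
  have F_insert: "(\<Prod>p | p \<in> insert q A \<and> p dvd d. 1 + g / real p)
      = F d + (if q dvd d then g / real q * F d else 0)" for d
  proof (cases "q dvd d")
    case True
    have "{p. p \<in> insert q A \<and> p dvd d} = insert q {p. p \<in> A \<and> p dvd d}" using True by auto
    thus ?thesis using insert True by (simp add: F_def algebra_simps)
  next
    case False
    have "{p. p \<in> insert q A \<and> p dvd d} = {p. p \<in> A \<and> p dvd d}" using False by auto
    thus ?thesis using False by (simp add: F_def)
  qed
  have F_mult: "F (q * e) = F e" for e
  proof -
    have "{p. p \<in> A \<and> p dvd q * e} = {p. p \<in> A \<and> p dvd e}"
    proof (intro Collect_cong conj_cong refl)
      fix p assume "p \<in> A"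
      hence "prime p" "p \<noteq> q" using insert by auto
      thus "(p dvd q * e) = (p dvd e)"
        using q by (auto simp: prime_dvd_mult_iff dest: primes_dvd_imp_eq)
    qed
    thus ?thesis by (simp add: F_def)
  qed
  have "(\<Sum>d=1..n. \<Prod>p | p \<in> insert q A \<and> p dvd d. 1 + g / real p)
     = (\<Sum>d=1..n. F d) + g / real q * (\<Sum>d | d \<in> {1..n} \<and> q dvd d. F d)"
    unfolding F_insert sum.distrib
    by (simp add: sum.inter_filter[symmetric] sum_distrib_left)
  also have "\<dots> = (\<Sum>d=1..n. F d) + g / real q * (\<Sum>e=1..n div q. F e)"
    unfolding sum_multiples[OF q(2)] F_mult ..
  also have "\<dots> \<le> real n * R + g / real q * (real (n div q) * R)"
    using IH assms(3) by (intro add_mono mult_left_mono) auto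
  also have "\<dots> \<le> real n * R + g / real q * (real n / real q * R)"
    using assms(3) R0 by (intro add_mono mult_left_mono mult_right_mono of_nat_div_le_of_nat) auto
  also have "\<dots> = real n * (\<Prod>p\<in>insert q A. 1 + g / real p ^ 2)"
    using insert by (simp add: R_def algebra_simps power2_eq_square)
  finally show ?case .
qed simp

text \<open>Convexity puts \<open>exp\<close> below its chord from \<open>0\<close> to
  \<open>B\<close>. With \<open>x = 1 / p\<close> this produces the weights \<open>1 + g / p\<close>
  of \<open>sum_prod_dvd_le\<close>, with \<open>g = exp B\<close>.\<close>

lemma exp_times_fraction_le:
  fixes B x :: real
  assumes "0 \<le> x" "x \<le> 1"
  shows "exp (B * x) \<le> 1 + exp B * x"
proof -
  have "convex_on UNIV exp" by (rule exp_convex)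
  from convex_onD[OF this, of x 0 B] assms have "exp (x * B) \<le> (1 - x) + x * exp B"
    by simp
  thus ?thesis using assms by (simp add: algebra_simps)
qed

text \<open>The exponential of the sum is a product over the primes dividing \<open>d\<close>, which
  \<open>sum_prod_dvd_le\<close> averages. The resulting product of \<open>1 + exp B / p^2\<close>
  is at most \<open>exp (exp B * 2)\<close>, where \<open>2\<close> bounds the sum of the inverse
  squares.\<close>

lemma exp_prime_recip_sum_moment:
  assumes "B \<ge> 0"
  shows "(\<Sum>d=1..n. exp (B * prime_recip_sum 0 d)) \<le> exp (2 * exp B) * real n"
proof -
  define A where "A = {p. prime p \<and> p \<le> n}"
  have fin: "finite A" unfolding A_def by auto
  have "(\<Sum>p\<in>A. 1 / real p ^ 2) \<le> (\<Sum>p=1..n. 1 / real p ^ 2)"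
    by (rule sum_mono2) (auto simp: A_def dest: prime_gt_0_nat)
  also have "\<dots> \<le> 2" by (rule sum_inverse_squares_le)
  finally have sq: "(\<Sum>p\<in>A. 1 / real p ^ 2) \<le> 2" .
  have "(\<Prod>p\<in>A. 1 + exp B / real p ^ 2) \<le> (\<Prod>p\<in>A. exp (exp B * (1 / real p ^ 2)))"
    by (intro prod_mono conjI) (auto intro: add_nonneg_nonneg)
  also have "\<dots> = exp (exp B * (\<Sum>p\<in>A. 1 / real p ^ 2))"
    unfolding sum_distrib_left using fin by (intro exp_sum[symmetric])
  also have "\<dots> \<le> exp (exp B * 2)"
    using sq by simp
  finally have prod_le: "(\<Prod>p\<in>A. 1 + exp B / real p ^ 2) \<le> exp (exp B * 2)" .
  have "(\<Sum>d=1..n. exp (B * prime_recip_sum 0 d))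
      \<le> (\<Sum>d=1..n. \<Prod>p | p \<in> A \<and> p dvd d. 1 + exp B / real p)"
  proof (rule sum_mono)
    fix d assume d: "d \<in> {1..n}"
    have eq: "{p. prime p \<and> p dvd d \<and> 0 < p} = {p. p \<in> A \<and> p dvd d}"
      using d by (auto simp: A_def prime_gt_0_nat dest: dvd_imp_le)
    have "exp (B * prime_recip_sum 0 d) = (\<Prod>p | p \<in> A \<and> p dvd d. exp (B * (1 / real p)))"
      unfolding prime_recip_sum_def eq sum_distrib_left using fin by (intro exp_sum) auto
    also have "\<dots> \<le> (\<Prod>p | p \<in> A \<and> p dvd d. 1 + exp B * (1 / real p))"
      by (intro prod_mono conjI exp_times_fraction_le)
         (auto simp: A_def dest: prime_gt_0_nat)
    finally show "exp (B * prime_recip_sum 0 d) \<le> (\<Prod>p | p \<in> A \<and> p dvd d. 1 + exp B / real p)"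
      by simp
  qed
  also have "\<dots> \<le> real n * (\<Prod>p\<in>A. 1 + exp B / real p ^ 2)"
    by (rule sum_prod_dvd_le) (auto simp: fin A_def)
  also have "\<dots> \<le> real n * exp (exp B * 2)"
    using prod_le by (intro mult_left_mono) auto
  finally show ?thesis by (simp add: mult.commute)
qed

lemma prime_recip_sum_prime_mult:
  assumes "prime p" "d > 0"
  shows "prime_recip_sum 0 (p * d) \<le> 1 / real p + prime_recip_sum 0 d"
proof -
  let ?D = "{q. prime q \<and> q dvd d \<and> 0 < q}"
  have fin: "finite ?D" using finite_primes_dvd[OF assms(2)] .
  have "{q. prime q \<and> q dvd p * d \<and> 0 < q} \<subseteq> insert p ?D"
    using assms by (auto simp: prime_dvd_mult_iff dest: primes_dvd_imp_eq)
  hence "prime_recip_sum 0 (p * d) \<le> (\<Sum>q\<in>insert p ?D. 1 / real q)"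
    unfolding prime_recip_sum_def using fin by (intro sum_mono2) auto
  also have "\<dots> \<le> 1 / real p + (\<Sum>q\<in>?D. 1 / real q)"
    using fin by (cases "p \<in> ?D") (auto simp: insert_absorb)
  finally show ?thesis by (simp add: prime_recip_sum_def)
qed

text \<open>One factor of the square keeps the condition \<open>Q < p\<close>, the other is relaxed
  to level \<open>0\<close>. After the sums are exchanged, each prime contributes
  \<open>1 / p\<close> from its term and another \<open>1 / p\<close> from the density of its
  multiples \<open>d = p * e\<close>, so the tail of the inverse squares gives \<open>1 / Q\<close>.
  What is left is a first moment at level \<open>0\<close>, bounded through
  \<open>t \<le> exp t\<close> by the exponential moment with \<open>B = 1\<close>.\<close>

lemma prime_recip_sum_square_moment:
  assumes "Q \<ge> 1"
  shows "(\<Sum>d=1..n. prime_recip_sum Q d ^ 2) \<le> (1 + exp (2 * exp 1)) * real n / real Q"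
proof -
  define K where "K = exp (2 * exp (1::real))"
  define A where "A = {p. prime p \<and> Q < p \<and> p \<le> n}"
  have "(\<Sum>d=1..n. prime_recip_sum Q d ^ 2)
      \<le> (\<Sum>d=1..n. \<Sum>p\<in>A. if p dvd d then 1 / real p * prime_recip_sum 0 d else 0)"
  proof (rule sum_mono)
    fix d assume d: "d \<in> {1..n}"
    have eq: "{p. prime p \<and> p dvd d \<and> Q < p} = {p \<in> A. p dvd d}"
      using d by (auto simp: A_def dest: dvd_imp_le)
    have "prime_recip_sum Q d ^ 2 \<le> prime_recip_sum Q d * prime_recip_sum 0 d"
      unfolding power2_eq_square using d
      by (intro mult_left_mono prime_recip_sum_antimono prime_recip_sum_nonneg) auto
    also have "\<dots> = (\<Sum>p\<in>A. if p dvd d then 1 / real p * prime_recip_sum 0 d else 0)"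
      unfolding prime_recip_sum_def[of Q] eq sum_distrib_right
      by (rule sum.inter_filter) (auto simp: A_def)
    finally show "prime_recip_sum Q d ^ 2 \<le> \<dots>" .
  qed
  also have "\<dots> = (\<Sum>p\<in>A. \<Sum>d=1..n. if p dvd d then 1 / real p * prime_recip_sum 0 d else 0)"
    by (rule sum.swap)
  also have "\<dots> \<le> (\<Sum>p\<in>A. (1 + K) * real n * (1 / real p ^ 2))"
  proof (rule sum_mono)
    fix p assume "p \<in> A"
    hence p: "prime p" "p > 0" by (auto simp: A_def dest: prime_gt_0_nat)
    have "(\<Sum>d=1..n. if p dvd d then 1 / real p * prime_recip_sum 0 d else 0)
        = 1 / real p * (\<Sum>d | d \<in> {1..n} \<and> p dvd d. prime_recip_sum 0 d)"
      by (simp add: sum.inter_filter[symmetric] sum_distrib_left)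
    also have "\<dots> = 1 / real p * (\<Sum>e=1..n div p. prime_recip_sum 0 (p * e))"
      unfolding sum_multiples[OF p(2)] ..
    also have "(\<Sum>e=1..n div p. prime_recip_sum 0 (p * e))
        \<le> (\<Sum>e=1..n div p. 1 + exp (1 * prime_recip_sum 0 e))"
    proof (rule sum_mono)
      fix e assume e: "e \<in> {1..n div p}"
      have "prime_recip_sum 0 (p * e) \<le> 1 / real p + prime_recip_sum 0 e"
        using p e by (intro prime_recip_sum_prime_mult) auto
      also have "\<dots> \<le> 1 + exp (1 * prime_recip_sum 0 e)"
        using p order_trans[OF _ exp_ge_add_one_self[of "prime_recip_sum 0 e"]]
        by (intro add_mono) (auto simp: prime_recip_sum_nonneg)
      finally show "prime_recip_sum 0 (p * e) \<le> 1 + exp (1 * prime_recip_sum 0 e)" .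
    qed
    also have "\<dots> \<le> real (n div p) + K * real (n div p)"
      unfolding sum.distrib K_def using exp_prime_recip_sum_moment[of 1 "n div p"] by simp
    also have "\<dots> = (1 + K) * real (n div p)" by (simp add: algebra_simps)
    also have "\<dots> \<le> (1 + K) * (real n / real p)"
      by (intro mult_left_mono of_nat_div_le_of_nat) (auto simp: K_def add_nonneg_nonneg)
    finally show "(\<Sum>d=1..n. if p dvd d then 1 / real p * prime_recip_sum 0 d else 0)
        \<le> (1 + K) * real n * (1 / real p ^ 2)"
      using p by (simp add: mult_left_mono power2_eq_square field_simps)
  qed
  also have "\<dots> = (1 + K) * real n * (\<Sum>p\<in>A. 1 / real p ^ 2)"
    by (rule sum_distrib_left[symmetric])
  also have "\<dots> \<le> (1 + K) * real n * (\<Sum>p\<in>{Q<..n}. 1 / real p ^ 2)"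
    by (intro mult_left_mono sum_mono2) (auto simp: A_def K_def add_nonneg_nonneg)
  also have "\<dots> \<le> (1 + K) * real n * (1 / real Q)"
    using assms by (intro mult_left_mono sum_inverse_squares_Ioc_le) (auto simp: K_def add_nonneg_nonneg)
  finally show ?thesis by (simp add: K_def)
qed

section \<open>Bounds for Euler factors\<close>

definition euler_term :: "nat list \<Rightarrow> nat \<Rightarrow> real" where
  "euler_term hs n = (if prime n then euler_factor hs n else 1)"

definition partial_series :: "nat \<Rightarrow> nat list \<Rightarrow> real" where
  "partial_series Q hs = (\<Prod>n\<le>Q. euler_term hs n)"

definition index_pairs :: "nat \<Rightarrow> (nat \<times> nat) set" where
  "index_pairs k = {(i, j). j < i \<and> i < k}"

definition nat_dist :: "nat \<Rightarrow> nat \<Rightarrow> nat" where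
  "nat_dist a b = nat \<bar>int a - int b\<bar>"

text \<open>For distinct entries this majorises the sum of \<open>1 / p\<close> over the primes
  \<open>p > Q\<close> at which two entries become congruent. A prime is counted once for every
  colliding pair, so that moments can be estimated one pair at a time.\<close>

definition collision_sum :: "nat \<Rightarrow> nat list \<Rightarrow> real" where
  "collision_sum Q hs =
     (\<Sum>(i, j)\<in>index_pairs (length hs). prime_recip_sum Q (nat_dist (hs ! i) (hs ! j)))"

lemma finite_index_pairs: "finite (index_pairs k)"
  by (rule finite_subset[of _ "{..<k} \<times> {..<k}"]) (auto simp: index_pairs_def)

lemma nat_dist_pos: "a \<noteq> b \<Longrightarrow> nat_dist a b > 0"
  by (auto simp: nat_dist_def)

lemma collision_sum_nonneg: "collision_sum Q hs \<ge> 0"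
  unfolding collision_sum_def by (intro sum_nonneg) (auto simp: prime_recip_sum_nonneg)

lemma residue_count_le_length: "residue_count p hs \<le> length hs"
  unfolding residue_count_def by (meson List.finite_set card_image_le card_length le_trans)

lemma residue_count_le: "p > 0 \<Longrightarrow> residue_count p hs \<le> p"
  unfolding residue_count_def
  using card_mono[OF finite_lessThan, of "(\<lambda>a. a mod p) ` set hs" p] by (auto simp: image_subset_iff)

lemma residue_count_pos: "hs \<noteq> [] \<Longrightarrow> residue_count p hs \<ge> 1"
  unfolding residue_count_def by (simp add: Suc_le_eq card_gt_0_iff)

text \<open>Pigeonhole: reduction modulo \<open>p\<close> is not injective on the entries.\<close>

lemma residue_count_less_imp_dvd:
  assumes "distinct hs" "residue_count p hs < length hs"
  obtains i j where "(i, j) \<in> index_pairs (length hs)" "p dvd nat_dist (hs ! i) (hs ! j)"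
proof -
  have "\<not> inj_on (\<lambda>a. a mod p) (set hs)"
    using assms card_image[of "\<lambda>a. a mod p" "set hs"] distinct_card[of hs]
    unfolding residue_count_def by auto
  then obtain a b where ab: "a \<in> set hs" "b \<in> set hs" "a mod p = b mod p" "a \<noteq> b"
    by (auto simp: inj_on_def)
  then obtain i j where ij: "i < length hs" "j < length hs" "hs ! i = a" "hs ! j = b"
    by (auto simp: in_set_conv_nth)
  \<comment> \<open>Both orders are recorded, because \<open>index_pairs\<close> has the larger
    index first and it is not known which of \<open>i\<close>, \<open>j\<close> is larger.\<close>
  have "p dvd nat_dist a b" "p dvd nat_dist b a"
    using ab(3) mod_eq_iff_dvd_symdiff_nat[of a p b] mod_eq_iff_dvd_symdiff_nat[of b p a]
    by (simp_all add: nat_dist_def)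
  moreover have "i \<noteq> j" using ij ab by auto
  ultimately show ?thesis using ij that[of i j] that[of j i]
    by (cases "i < j") (auto simp: index_pairs_def)
qed

lemma euler_factor_nonneg:
  assumes "prime p"
  shows "euler_factor hs p \<ge> 0"
proof -
  have "real (residue_count p hs) / real p \<le> 1"
    using residue_count_le[of p hs] prime_gt_0_nat[OF assms] by simp
  moreover have "1 / real p \<le> 1" using prime_gt_0_nat[OF assms] by simp
  ultimately show ?thesis unfolding euler_factor_def
    by (intro mult_nonneg_nonneg zero_le_power_int) auto
qed

text \<open>From \<open>x \<le> - ln (1 - x) \<le> x + 2 * x^2\<close> on \<open>[0, 1/2]\<close>,
  which contains \<open>1 / p\<close> for every prime \<open>p\<close>.\<close>

lemma powi_bounds:
  fixes x :: real
  assumes "0 \<le> x" "x \<le> 1/2"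
  shows "(1 - x) powi (- int k) \<le> exp (real k * (x + 2 * x ^ 2))"
    and "exp (real k * x) \<le> (1 - x) powi (- int k)"
proof -
  have "(1 - x) powi (- int k) = exp (real k * (- ln (1 - x)))"
    using assms by (simp add: power_int_minus exp_of_nat_mult exp_minus power_inverse)
  moreover have "real k * - ln (1 - x) \<le> real k * (x + 2 * x ^ 2)"
    using ln_one_minus_pos_lower_bound[of x] assms by (intro mult_left_mono) auto
  moreover have "real k * x \<le> real k * - ln (1 - x)"
    using ln_one_minus_pos_upper_bound[of x] assms by (intro mult_left_mono) auto
  ultimately show "(1 - x) powi (- int k) \<le> exp (real k * (x + 2 * x ^ 2))"
    "exp (real k * x) \<le> (1 - x) powi (- int k)"
    by simp_all
qed

text \<open>Combining \<open>1 - \<nu> * x \<le> exp (- \<nu> * x)\<close> with the upper bound for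
  \<open>(1 - x) powi (- k)\<close> leaves the linear term \<open>(k - \<nu>) * x\<close>, which
  vanishes unless entries collide modulo \<open>p\<close>. The quadratic coefficient
  \<open>2 * k\<close> is weakened to \<open>2 * k^2\<close> to agree with the lower bound.\<close>

lemma euler_factor_upper:
  assumes "prime p" "length hs = k" "k \<ge> 1"
  shows "euler_factor hs p \<le>
    exp (2 * real k ^ 2 * (1 / real p ^ 2) + real k * (if residue_count p hs < k then 1 / real p else 0))"
proof -
  define x where "x = 1 / real p"
  define \<nu> where "\<nu> = residue_count p hs"
  have p: "p \<ge> 2" using assms prime_ge_2_nat by auto
  have x: "0 \<le> x" "x \<le> 1/2" using p by (auto simp: x_def field_simps)
  have hs: "hs \<noteq> []" using assms by auto
  have \<nu>: "1 \<le> \<nu>" "\<nu> \<le> k" using residue_count_pos[OF hs] residue_count_le_length assms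
    by (auto simp: \<nu>_def)
  have "euler_factor hs p = (1 - real \<nu> * x) * (1 - x) powi (- int k)"
    using assms by (simp add: euler_factor_def x_def \<nu>_def)
  also have "\<dots> \<le> exp (- (real \<nu> * x)) * exp (real k * (x + 2 * x ^ 2))"
    using x exp_ge_add_one_self[of "- (real \<nu> * x)"]
    by (intro mult_mono powi_bounds zero_le_power_int) auto
  also have "\<dots> = exp (2 * real k * x ^ 2 + (real k - real \<nu>) * x)"
    by (simp add: exp_add[symmetric] algebra_simps)
  also have "\<dots> \<le> exp (2 * real k ^ 2 * x ^ 2 + real k * (if \<nu> < k then x else 0))"
  proof -
    have "real k \<le> real k ^ 2" using assms by (simp add: power2_eq_square)
    hence "2 * real k * x ^ 2 \<le> 2 * real k ^ 2 * x ^ 2"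
      by (intro mult_right_mono) auto
    moreover have "(real k - real \<nu>) * x \<le> real k * (if \<nu> < k then x else 0)"
      using \<nu> x by (auto intro: mult_right_mono)
    ultimately show ?thesis by simp
  qed
  finally show ?thesis unfolding x_def \<nu>_def power_one_over .
qed

text \<open>Collisions only enlarge the factor, so \<open>\<nu>\<close> may be replaced by
  \<open>k\<close> and no collision term appears. As \<open>k / p \<le> 1/2\<close>, the logarithm
  bound applies to \<open>1 - k * x\<close>; its linear term cancels against
  \<open>exp (k * x) \<le> (1 - x) powi (- k)\<close>, and its quadratic term is the loss.\<close>

lemma euler_factor_lower:
  assumes "prime p" "length hs = k" "k \<ge> 1" "p \<ge> 2 * k"
  shows "euler_factor hs p \<ge> exp (- (2 * real k ^ 2 * (1 / real p ^ 2)))"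
proof -
  define x where "x = 1 / real p"
  define \<nu> where "\<nu> = residue_count p hs"
  have p: "p \<ge> 2" using assms prime_ge_2_nat by auto
  have x: "0 \<le> x" "x \<le> 1/2" using p by (auto simp: x_def field_simps)
  have \<nu>: "\<nu> \<le> k" using residue_count_le_length assms by (auto simp: \<nu>_def)
  have kx: "real k * x \<le> 1 / 2" using assms p by (simp add: x_def field_simps)
  have "exp (- (2 * real k ^ 2 * x ^ 2)) = exp (- (real k * x) - 2 * (real k * x) ^ 2) * exp (real k * x)"
    by (simp add: exp_add[symmetric] power_mult_distrib)
  also have "\<dots> \<le> exp (ln (1 - real k * x)) * (1 - x) powi (- int k)"
  proof (intro mult_mono powi_bounds x)
    show "exp (- (real k * x) - 2 * (real k * x) ^ 2) \<le> exp (ln (1 - real k * x))"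
      using x kx ln_one_minus_pos_lower_bound[of "real k * x"] by (intro iffD2[OF exp_le_cancel_iff]) auto
  qed auto
  also have "\<dots> = (1 - real k * x) * (1 - x) powi (- int k)"
    using kx by simp
  also have "\<dots> \<le> (1 - real \<nu> * x) * (1 - x) powi (- int k)"
    using \<nu> x by (intro mult_right_mono zero_le_power_int) (auto intro: mult_right_mono)
  also have "\<dots> = euler_factor hs p"
    using assms by (simp add: euler_factor_def x_def \<nu>_def)
  finally show ?thesis by (simp add: x_def power_divide)
qed

text \<open>Each prime with a deficient residue count divides some difference of entries; it is
  charged to all such pairs, and the sums over primes and pairs are exchanged.\<close>

lemma sum_collision_le:
  assumes "distinct hs" "finite A" "\<And>p. p \<in> A \<Longrightarrow> prime p \<and> Q < p"
  shows "(\<Sum>p\<in>A. if residue_count p hs < length hs then 1 / real p else 0) \<le> collision_sum Q hs"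
proof -
  let ?P = "index_pairs (length hs)"
  let ?d = "\<lambda>i j. nat_dist (hs ! i) (hs ! j)"
  have "(\<Sum>p\<in>A. if residue_count p hs < length hs then 1 / real p else 0)
      \<le> (\<Sum>p\<in>A. \<Sum>(i, j)\<in>?P. if p dvd ?d i j then 1 / real p else 0)"
  proof (rule sum_mono)
    fix p assume "p \<in> A"
    show "(if residue_count p hs < length hs then 1 / real p else 0)
        \<le> (\<Sum>(i, j)\<in>?P. if p dvd ?d i j then 1 / real p else 0)"
    proof (cases "residue_count p hs < length hs")
      case True
      then obtain i j where ij: "(i, j) \<in> ?P" "p dvd ?d i j"
        using residue_count_less_imp_dvd[OF assms(1)] by blast
      have "(\<lambda>(i, j). if p dvd ?d i j then 1 / real p else 0) (i, j)
         \<le> (\<Sum>(i, j)\<in>?P. if p dvd ?d i j then 1 / real p else 0)"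
        using ij by (intro member_le_sum[OF _ _ finite_index_pairs]) (auto simp: case_prod_beta)
      thus ?thesis using True ij by simp
    qed (auto intro!: sum_nonneg)
  qed
  also have "\<dots> = (\<Sum>(i, j)\<in>?P. \<Sum>p\<in>A. if p dvd ?d i j then 1 / real p else 0)"
    unfolding case_prod_beta by (rule sum.swap)
  also have "\<dots> \<le> collision_sum Q hs"
    unfolding collision_sum_def
  proof (rule sum_mono, clarify)
    fix i j assume ij: "(i, j) \<in> ?P"
    hence "?d i j > 0" using assms(1)
      by (intro nat_dist_pos) (auto simp: index_pairs_def nth_eq_iff_index_eq)
    thus "(\<Sum>p\<in>A. if p dvd ?d i j then 1 / real p else 0) \<le> prime_recip_sum Q (?d i j)"
      unfolding prime_recip_sum_def sum.inter_filter[OF assms(2), symmetric]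
      using assms(3) by (intro sum_mono2 finite_primes_dvd) auto
  qed
  finally show ?thesis .
qed

text \<open>The parameter \<open>s\<close> serves two uses: the tail beyond \<open>Q\<close>, with
  \<open>s = 1 / Q\<close>, and the full truncated product, with level \<open>0\<close> and
  \<open>s = 2\<close>.\<close>

lemma prod_euler_term_upper:
  assumes "distinct hs" "length hs = k" "k \<ge> 1" "finite A"
    "\<And>n. n \<in> A \<Longrightarrow> Q < n" "(\<Sum>n\<in>A. 1 / real n ^ 2) \<le> s"
  shows "(\<Prod>n\<in>A. euler_term hs n) \<le> exp (2 * real k ^ 2 * s + real k * collision_sum Q hs)"
proof -
  let ?A = "{n \<in> A. prime n}"
  let ?c = "\<lambda>p. if residue_count p hs < k then 1 / real p else 0"
  have "(\<Prod>n\<in>A. euler_term hs n) = (\<Prod>p\<in>?A. euler_factor hs p)"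
    unfolding euler_term_def using assms by (intro prod.inter_filter[symmetric])
  also have "\<dots> \<le> (\<Prod>p\<in>?A. exp (2 * real k ^ 2 * (1 / real p ^ 2) + real k * ?c p))"
    using assms by (intro prod_mono conjI euler_factor_nonneg euler_factor_upper) auto
  also have "\<dots> = exp (2 * real k ^ 2 * (\<Sum>p\<in>?A. 1 / real p ^ 2) + real k * (\<Sum>p\<in>?A. ?c p))"
    using assms by (subst exp_sum[symmetric]) (auto simp: sum.distrib sum_distrib_left)
  also have "\<dots> \<le> exp (2 * real k ^ 2 * s + real k * collision_sum Q hs)"
  proof -
    have "(\<Sum>p\<in>?A. 1 / real p ^ 2) \<le> (\<Sum>p\<in>A. 1 / real p ^ 2)"
      using assms by (intro sum_mono2) auto
    hence "(\<Sum>p\<in>?A. 1 / real p ^ 2) \<le> s" using assms by linarith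
    moreover have "(\<Sum>p\<in>?A. ?c p) \<le> collision_sum Q hs"
      unfolding assms(2)[symmetric] using assms(1,4,5) by (intro sum_collision_le) auto
    ultimately have "2 * real k ^ 2 * (\<Sum>p\<in>?A. 1 / real p ^ 2) \<le> 2 * real k ^ 2 * s"
      "real k * (\<Sum>p\<in>?A. ?c p) \<le> real k * collision_sum Q hs"
      by (auto intro: mult_left_mono)
    thus ?thesis by simp
  qed
  finally show ?thesis .
qed

lemma prod_euler_term_lower:
  assumes "length hs = k" "k \<ge> 1" "finite A"
    "\<And>n. n \<in> A \<Longrightarrow> 2 * k \<le> n" "(\<Sum>n\<in>A. 1 / real n ^ 2) \<le> s"
  shows "exp (- (2 * real k ^ 2 * s)) \<le> (\<Prod>n\<in>A. euler_term hs n)"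
proof -
  let ?A = "{n \<in> A. prime n}"
  have "(\<Sum>p\<in>?A. 1 / real p ^ 2) \<le> (\<Sum>p\<in>A. 1 / real p ^ 2)"
    using assms by (intro sum_mono2) auto
  hence "2 * real k ^ 2 * (\<Sum>p\<in>?A. 1 / real p ^ 2) \<le> 2 * real k ^ 2 * s"
    using assms by (intro mult_left_mono) auto
  hence "exp (- (2 * real k ^ 2 * s)) \<le> exp (\<Sum>p\<in>?A. - (2 * real k ^ 2 * (1 / real p ^ 2)))"
    by (simp add: sum_negf sum_distrib_left)
  also have "\<dots> = (\<Prod>p\<in>?A. exp (- (2 * real k ^ 2 * (1 / real p ^ 2))))"
    using assms by (intro exp_sum) auto
  also have "\<dots> \<le> (\<Prod>p\<in>?A. euler_factor hs p)"
    using assms by (intro prod_mono conjI euler_factor_lower) auto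
  also have "\<dots> = (\<Prod>n\<in>A. euler_term hs n)"
    unfolding euler_term_def using assms by (intro prod.inter_filter)
  finally show ?thesis .
qed

text \<open>A prime larger than all differences of entries sees no collision, so from some point on
  the upper and lower bounds confine the factor to \<open>1 + O(1 / n^2)\<close>.\<close>

lemma convergent_prod_euler_term:
  assumes "distinct hs" "hs \<noteq> []"
  shows "convergent_prod (euler_term hs)"
proof -
  define k where "k = length hs"
  define C where "C = 2 * real k ^ 2"
  \<comment> \<open>The sum of all differences is a convenient bound for each of them.\<close>
  define M where "M = (\<Sum>(i, j)\<in>index_pairs k. nat_dist (hs ! i) (hs ! j))"
  have k: "k \<ge> 1" using assms by (simp add: k_def Suc_le_eq)
  have "summable (\<lambda>n. norm (euler_term hs n - 1))"
  proof (rule summable_comparison_test_ev)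
    show "summable (\<lambda>n. (C * exp C) * (1 / real n ^ 2))"
      using inverse_power_summable[of 2, where 'a = real]
      by (intro summable_mult) (simp add: divide_inverse)
    have "norm (norm (euler_term hs n - 1)) \<le> (C * exp C) * (1 / real n ^ 2)"
      if n: "n > M + 2 * k" for n
    proof (cases "prime n")
      case True
      define y where "y = C * (1 / real n ^ 2)"
      have n1: "real n \<ge> 1" using n k by simp
      have "1 / real n ^ 2 \<le> 1" using n1 by simp
      hence "C * (1 / real n ^ 2) \<le> C * 1" by (intro mult_left_mono) (auto simp: C_def)
      hence y: "0 \<le> y" "y \<le> C" by (simp_all add: y_def C_def)
      have "\<not> residue_count n hs < k"
      proof
        assume "residue_count n hs < k"
        then obtain i j where ij: "(i, j) \<in> index_pairs k" "n dvd nat_dist (hs ! i) (hs ! j)"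
          using residue_count_less_imp_dvd[of hs n] assms(1) unfolding k_def by blast
        have "nat_dist (hs ! i) (hs ! j) > 0"
          using ij assms by (intro nat_dist_pos) (auto simp: index_pairs_def nth_eq_iff_index_eq k_def)
        hence "n \<le> nat_dist (hs ! i) (hs ! j)" using ij by (intro dvd_imp_le)
        also have "\<dots> = (\<lambda>(i, j). nat_dist (hs ! i) (hs ! j)) (i, j)" by simp
        also have "\<dots> \<le> M" unfolding M_def
          using ij by (intro member_le_sum[OF _ _ finite_index_pairs]) auto
        finally show False using n by simp
      qed
      hence "euler_factor hs n \<le> exp y"
        using euler_factor_upper[OF True, of hs k] k by (simp add: k_def y_def C_def)
      moreover have "exp (- y) \<le> euler_factor hs n"
        using euler_factor_lower[OF True, of hs k] k n by (simp add: k_def y_def C_def)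
      moreover have "exp y - 1 \<le> y * exp C"
      proof -
        have "exp y * (1 - y) \<le> exp y * exp (- y)"
          using exp_ge_add_one_self[of "- y"] by (intro mult_left_mono) auto
        hence "exp y - 1 \<le> y * exp y" by (simp add: exp_minus algebra_simps)
        also have "\<dots> \<le> y * exp C" using y by (intro mult_left_mono) auto
        finally show ?thesis .
      qed
      moreover have "1 - exp (- y) \<le> y * exp C"
      proof -
        have "1 - exp (- y) \<le> y * 1" using exp_ge_add_one_self[of "- y"] by linarith
        also have "\<dots> \<le> y * exp C" using y by (intro mult_left_mono) auto
        finally show ?thesis .
      qed
      ultimately have "\<bar>euler_factor hs n - 1\<bar> \<le> y * exp C" by linarith
      thus ?thesis using True by (simp add: euler_term_def y_def mult_ac)
    qed (auto simp: euler_term_def C_def)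
    thus "eventually (\<lambda>n. norm (norm (euler_term hs n - 1)) \<le> (C * exp C) * (1 / real n ^ 2)) sequentially"
      using eventually_gt_at_top[of "M + 2 * k"] by (rule eventually_mono[rotated])
  qed
  thus ?thesis
    by (intro abs_convergent_prod_imp_convergent_prod summable_imp_abs_convergent_prod)
qed

text \<open>The factors in \<open>{Q<..N}\<close> are bounded uniformly in \<open>N\<close>, and
  then \<open>N\<close> tends to infinity. The multiplicative form matters: if a factor up to
  \<open>Q\<close> vanishes, both bounds force the singular series to be \<open>0\<close>.\<close>

lemma singular_series_bounds:
  assumes "distinct hs" "length hs = k" "k \<ge> 1" "Q \<ge> 2 * k"
  shows "singular_series hs \<le>
      partial_series Q hs * exp (2 * real k ^ 2 * (1 / real Q) + real k * collision_sum Q hs)"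
    and "partial_series Q hs * exp (- (2 * real k ^ 2 * (1 / real Q))) \<le> singular_series hs"
proof -
  have hs: "hs \<noteq> []" using assms by auto
  have lim: "(\<lambda>N. partial_series N hs) \<longlonglongrightarrow> singular_series hs"
    using convergent_prod_LIMSEQ[OF convergent_prod_euler_term[OF assms(1) hs]]
    by (simp add: partial_series_def singular_series_def euler_term_def[abs_def])
  have nonneg: "partial_series Q hs \<ge> 0" unfolding partial_series_def euler_term_def
    by (intro prod_nonneg) (auto simp: euler_factor_nonneg)
  have split: "partial_series N hs = partial_series Q hs * (\<Prod>n\<in>{Q<..N}. euler_term hs n)"
    if "N \<ge> Q" for N
  proof -
    have "{..N} = {..Q} \<union> {Q<..N}" using that by auto
    thus ?thesis unfolding partial_series_def by (simp add: prod.union_disjoint disjoint_iff)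
  qed
  have sq: "(\<Sum>n\<in>{Q<..N}. 1 / real n ^ 2) \<le> 1 / real Q" for N
    using assms by (intro sum_inverse_squares_Ioc_le) auto
  have "partial_series N hs \<le>
      partial_series Q hs * exp (2 * real k ^ 2 * (1 / real Q) + real k * collision_sum Q hs)"
    if "N \<ge> Q" for N
    unfolding split[OF that] using assms sq nonneg
    by (intro mult_left_mono prod_euler_term_upper) auto
  thus "singular_series hs \<le>
      partial_series Q hs * exp (2 * real k ^ 2 * (1 / real Q) + real k * collision_sum Q hs)"
    using lim by (intro LIMSEQ_le_const2) blast+
  have "partial_series Q hs * exp (- (2 * real k ^ 2 * (1 / real Q))) \<le> partial_series N hs"
    if "N \<ge> Q" for N
    unfolding split[OF that] using assms sq nonneg
    by (intro mult_left_mono prod_euler_term_lower) auto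
  thus "partial_series Q hs * exp (- (2 * real k ^ 2 * (1 / real Q))) \<le> singular_series hs"
    using lim by (intro LIMSEQ_le_const) blast+
qed

section \<open>The truncation error on average\<close>

lemma finite_distinct_tuples: "finite (distinct_tuples k h)"
  by (rule finite_subset[OF _ finite_lists_length_eq[of "{1..h}" k]])
     (auto simp: distinct_tuples_def)

lemma card_distinct_tuples_le: "card (distinct_tuples k h) \<le> h ^ k"
  using card_mono[OF finite_lists_length_eq[of "{1..h}" k], of "distinct_tuples k h"]
  by (force simp: distinct_tuples_def card_lists_length_eq)

text \<open>A tuple is determined by \<open>hs ! j\<close> and its other entries away from \<open>i\<close>, together with the
  distance and the order of \<open>hs ! i\<close> and \<open>hs ! j\<close>.\<close>

lemma sum_distinct_tuples_nat_dist_le: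
  fixes G :: "nat \<Rightarrow> real"
  assumes "(i, j) \<in> index_pairs k" "\<And>d. G d \<ge> 0"
  shows "(\<Sum>hs\<in>distinct_tuples k h. G (nat_dist (hs ! i) (hs ! j)))
       \<le> 2 * real h ^ (k - 1) * (\<Sum>d=1..h. G d)"
proof -
  have ij: "j < i" "i < k" using assms(1) by (auto simp: index_pairs_def)
  define rest where "rest = (\<lambda>hs::nat list. take i hs @ drop (Suc i) hs)"
  define \<phi> where "\<phi> = (\<lambda>hs. (hs ! i > hs ! j, nat_dist (hs ! i) (hs ! j), rest hs))"
  define L where "L = {xs. set xs \<subseteq> {1..h} \<and> length xs = k - 1}"
  have inj: "inj_on \<phi> (distinct_tuples k h)"
  proof (rule inj_onI)
    fix hs hs' assume mem: "hs \<in> distinct_tuples k h" "hs' \<in> distinct_tuples k h"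
      and eq: "\<phi> hs = \<phi> hs'"
    hence len: "length hs = k" "length hs' = k" by (auto simp: distinct_tuples_def)
    have tk: "take i hs = take i hs'" "drop (Suc i) hs = drop (Suc i) hs'"
      using eq len by (auto simp: \<phi>_def rest_def)
    \<comment> \<open>Since \<open>j < i\<close>, the entry at \<open>j\<close> lies in the retained
      prefix.\<close>
    have j: "hs ! j = hs' ! j" using tk(1) ij by (metis nth_take)
    have "(hs ! i > hs ! j) = (hs' ! i > hs' ! j)"
      "nat_dist (hs ! i) (hs ! j) = nat_dist (hs' ! i) (hs' ! j)"
      using eq by (auto simp: \<phi>_def)
    hence "hs ! i = hs' ! i" using j by (auto simp: nat_dist_def)
    thus "hs = hs'" using tk ij len by (metis id_take_nth_drop)
  qed
  have sub: "\<phi> ` distinct_tuples k h \<subseteq> UNIV \<times> {1..h} \<times> L"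
  proof (rule image_subsetI)
    fix hs assume hs: "hs \<in> distinct_tuples k h"
    have len: "length hs = k" and dist: "distinct hs" and set: "set hs \<subseteq> {1..h}"
      using hs by (auto simp: distinct_tuples_def)
    have "hs ! i \<in> {1..h}" "hs ! j \<in> {1..h}" 
      using ij len subsetD[OF set nth_mem[of i hs]] subsetD[OF set nth_mem[of j hs]] by auto
    moreover have "hs ! i \<noteq> hs ! j" using dist ij len by (simp add: nth_eq_iff_index_eq)
    ultimately have "nat_dist (hs ! i) (hs ! j) \<in> {1..h}" by (auto simp: nat_dist_def)
    moreover have "set (rest hs) \<subseteq> {1..h}"
      using set set_take_subset[of i hs] set_drop_subset[of "Suc i" hs] by (auto simp: rest_def)
    ultimately show "\<phi> hs \<in> UNIV \<times> {1..h} \<times> L"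
      using ij len by (auto simp: \<phi>_def rest_def L_def)
  qed
  have finL: "finite L" unfolding L_def by (rule finite_lists_length_eq) simp
  have "(\<Sum>hs\<in>distinct_tuples k h. G (nat_dist (hs ! i) (hs ! j)))
      = (\<Sum>t\<in>\<phi> ` distinct_tuples k h. G (fst (snd t)))"
    by (subst sum.reindex[OF inj]) (simp add: \<phi>_def)
  also have "\<dots> \<le> (\<Sum>t\<in>(UNIV :: bool set) \<times> {1..h} \<times> L. G (fst (snd t)))"
    using sub finL assms(2) by (intro sum_mono2) auto
  also have "\<dots> = (\<Sum>b\<in>(UNIV :: bool set). \<Sum>d\<in>{1..h}. \<Sum>xs\<in>L. G d)"
    by (simp only: sum.cartesian_product) (simp add: case_prod_beta)
  also have "\<dots> = 2 * real (card L) * (\<Sum>d=1..h. G d)"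
    by (simp add: sum_distrib_left mult.assoc)
  also have "card L = h ^ (k - 1)"
    unfolding L_def by (subst card_lists_length_eq) auto
  finally show ?thesis by simp
qed

text \<open>The sum is at most \<open>card P\<close> times its largest term, and the exponential of
  that bound is one of the summands on the right; the \<open>1\<close> covers empty
  \<open>P\<close>. This reduces exponential moments over all pairs to those of single
  pairs.\<close>

lemma exp_sum_le_sum_exp:
  fixes w :: "'a \<Rightarrow> real"
  assumes "finite P" "B \<ge> 0"
  shows "exp (B * (\<Sum>x\<in>P. w x)) \<le> 1 + (\<Sum>x\<in>P. exp (B * real (card P) * w x))"
proof (cases "P = {}")
  case False
  define M where "M = Max (w ` P)"
  have "M \<in> w ` P" unfolding M_def using False assms by (intro Max_in) auto
  then obtain x where x: "x \<in> P" "w x = M" by auto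
  have "(\<Sum>x\<in>P. w x) \<le> real (card P) * M"
    using assms by (intro sum_bounded_above) (auto simp: M_def)
  hence "exp (B * (\<Sum>x\<in>P. w x)) \<le> exp (B * real (card P) * w x)"
    using x assms by (simp add: mult.assoc mult_left_mono)
  also have "\<dots> \<le> (\<Sum>x\<in>P. exp (B * real (card P) * w x))"
    using x assms by (intro member_le_sum) auto
  finally show ?thesis by simp
qed simp

lemma collision_sum_antimono:
  assumes "distinct hs" "Q \<le> R"
  shows "collision_sum R hs \<le> collision_sum Q hs"
  unfolding collision_sum_def using assms
  by (intro sum_mono) (auto intro!: prime_recip_sum_antimono nat_dist_pos
      simp: index_pairs_def nth_eq_iff_index_eq)

lemma exp_collision_sum_moment:
  assumes "k \<ge> 1" "B \<ge> 0"
  shows "\<exists>K. \<forall>h. (\<Sum>hs\<in>distinct_tuples k h. exp (B * collision_sum 0 hs)) \<le> K * real h ^ k"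
proof (intro exI allI)
  fix h
  let ?P = "index_pairs k"
  define N where "N = real (card ?P)"
  have "(\<Sum>hs\<in>distinct_tuples k h. exp (B * collision_sum 0 hs))
      \<le> (\<Sum>hs\<in>distinct_tuples k h. 1 +
          (\<Sum>ij\<in>?P. exp (B * N * prime_recip_sum 0 (nat_dist (hs ! fst ij) (hs ! snd ij)))))"
  proof (rule sum_mono)
    fix hs assume "hs \<in> distinct_tuples k h"
    hence "collision_sum 0 hs
        = (\<Sum>ij\<in>?P. prime_recip_sum 0 (nat_dist (hs ! fst ij) (hs ! snd ij)))"
      by (simp add: collision_sum_def case_prod_beta distinct_tuples_def)
    thus "exp (B * collision_sum 0 hs) \<le> 1 +
          (\<Sum>ij\<in>?P. exp (B * N * prime_recip_sum 0 (nat_dist (hs ! fst ij) (hs ! snd ij))))"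
      unfolding N_def using exp_sum_le_sum_exp[OF finite_index_pairs assms(2)] by simp
  qed
  also have "\<dots> = real (card (distinct_tuples k h)) + (\<Sum>ij\<in>?P. \<Sum>hs\<in>distinct_tuples k h.
      exp (B * N * prime_recip_sum 0 (nat_dist (hs ! fst ij) (hs ! snd ij))))"
    unfolding sum.distrib by (subst sum.swap) simp
  also have "\<dots> \<le> real h ^ k + (\<Sum>ij\<in>?P. 2 * real h ^ (k - 1) * (exp (2 * exp (B * N)) * real h))"
  proof (intro add_mono sum_mono)
    have "real (card (distinct_tuples k h)) \<le> real (h ^ k)"
      using card_distinct_tuples_le of_nat_le_iff by blast
    thus "real (card (distinct_tuples k h)) \<le> real h ^ k" by simp
  next
    fix ij assume "ij \<in> ?P"
    hence "(\<Sum>hs\<in>distinct_tuples k h.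
        exp (B * N * prime_recip_sum 0 (nat_dist (hs ! fst ij) (hs ! snd ij))))
      \<le> 2 * real h ^ (k - 1) * (\<Sum>d=1..h. exp (B * N * prime_recip_sum 0 d))"
      by (intro sum_distinct_tuples_nat_dist_le) auto
    also have "\<dots> \<le> 2 * real h ^ (k - 1) * (exp (2 * exp (B * N)) * real h)"
      using assms by (intro mult_left_mono exp_prime_recip_sum_moment) (auto simp: N_def)
    finally show "(\<Sum>hs\<in>distinct_tuples k h.
        exp (B * N * prime_recip_sum 0 (nat_dist (hs ! fst ij) (hs ! snd ij)))) \<le> \<dots>" .
  qed
  also have "\<dots> = (1 + 2 * N * exp (2 * exp (B * N))) * real h ^ k"
    using assms by (cases k) (auto simp: N_def algebra_simps)
  finally show "(\<Sum>hs\<in>distinct_tuples k h. exp (B * collision_sum 0 hs))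
      \<le> (1 + 2 * N * exp (2 * exp (B * N))) * real h ^ k" .
qed

text \<open>Cauchy-Schwarz over the pairs costs one factor \<open>N\<close>, and summing the
  \<open>N\<close> single-pair bounds costs another. The constant depends on neither
  \<open>h\<close> nor \<open>Q\<close>.\<close>

lemma collision_sum_square_moment:
  assumes "k \<ge> 1"
  shows "\<exists>K\<ge>0. \<forall>h. \<forall>Q\<ge>1.
      (\<Sum>hs\<in>distinct_tuples k h. collision_sum Q hs ^ 2) \<le> K * real h ^ k / real Q"
proof (intro exI conjI allI impI)
  let ?P = "index_pairs k"
  define N where "N = real (card ?P)"
  define c where "c = 1 + exp (2 * exp (1::real))"
  have c: "c \<ge> 0" by (auto simp: c_def add_nonneg_nonneg)
  thus "2 * N ^ 2 * c \<ge> 0" by simp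
  fix h Q :: nat assume Q: "Q \<ge> 1"
  have "(\<Sum>hs\<in>distinct_tuples k h. collision_sum Q hs ^ 2)
      \<le> (\<Sum>hs\<in>distinct_tuples k h.
          \<Sum>ij\<in>?P. prime_recip_sum Q (nat_dist (hs ! fst ij) (hs ! snd ij)) ^ 2 * N)"
  proof (rule sum_mono)
    fix hs assume "hs \<in> distinct_tuples k h"
    hence "collision_sum Q hs
        = (\<Sum>ij\<in>?P. prime_recip_sum Q (nat_dist (hs ! fst ij) (hs ! snd ij)))"
      by (simp add: collision_sum_def case_prod_beta distinct_tuples_def)
    thus "collision_sum Q hs ^ 2
        \<le> (\<Sum>ij\<in>?P. prime_recip_sum Q (nat_dist (hs ! fst ij) (hs ! snd ij)) ^ 2 * N)"
      unfolding N_def sum_distrib_right[symmetric] using sum_squared_le_sum_of_squares by simp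
  qed
  also have "\<dots> = (\<Sum>ij\<in>?P. N * (\<Sum>hs\<in>distinct_tuples k h.
      prime_recip_sum Q (nat_dist (hs ! fst ij) (hs ! snd ij)) ^ 2))"
    by (subst sum.swap) (simp add: sum_distrib_left mult.commute)
  also have "\<dots> \<le> (\<Sum>ij\<in>?P. N * (2 * real h ^ (k - 1) * (c * real h / real Q)))"
  proof (intro sum_mono mult_left_mono)
    fix ij assume "ij \<in> ?P"
    hence "(\<Sum>hs\<in>distinct_tuples k h. prime_recip_sum Q (nat_dist (hs ! fst ij) (hs ! snd ij)) ^ 2)
      \<le> 2 * real h ^ (k - 1) * (\<Sum>d=1..h. prime_recip_sum Q d ^ 2)"
      by (intro sum_distinct_tuples_nat_dist_le[where G = "\<lambda>d. prime_recip_sum Q d ^ 2"]) auto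
    also have "\<dots> \<le> 2 * real h ^ (k - 1) * (c * real h / real Q)"
      unfolding c_def using Q by (intro mult_left_mono prime_recip_sum_square_moment) auto
    finally show "(\<Sum>hs\<in>distinct_tuples k h.
      prime_recip_sum Q (nat_dist (hs ! fst ij) (hs ! snd ij)) ^ 2) \<le> \<dots>" .
  qed (auto simp: N_def)
  also have "\<dots> = 2 * N ^ 2 * c * real h ^ k / real Q"
    using assms by (cases k) (auto simp: N_def power2_eq_square algebra_simps)
  finally show "(\<Sum>hs\<in>distinct_tuples k h. collision_sum Q hs ^ 2)
      \<le> 2 * N ^ 2 * c * real h ^ k / real Q" .
qed

text \<open>For \<open>q > 0\<close> write \<open>s powr m = q powr m * exp (m * x)\<close> with
  \<open>x = ln s - ln q\<close>, so that \<open>|x| \<le> Y\<close>. Then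
  \<open>|q powr m| = exp (Re m * ln q)\<close> is controlled by \<open>E\<close> because
  \<open>Re m \<ge> 0\<close>, and \<open>|exp z - 1| \<le> |z| * exp |z|\<close>.\<close>

lemma norm_powr_diff_le:
  fixes m :: complex and s q E Y :: real
  assumes "Re m \<ge> 0" "0 \<le> q" "q \<le> exp E" "E \<ge> 0" and Y: "Y \<ge> 0"
    and "q * exp (- Y) \<le> s" "s \<le> q * exp Y"
  shows "norm (complex_of_real s powr m - of_real q powr m) \<le> norm m * Y * exp (norm m * (E + Y))"
proof -
  show ?thesis
  proof (cases "q = 0")
    \<comment> \<open>The two bounds force \<open>s = 0\<close>, and both powers are
      \<open>0\<close> by convention.\<close>
    case True
    with assms show ?thesis by simp
  next
    case False
    hence q: "q > 0" using assms by simp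
    have s: "s > 0" using q assms by (meson exp_gt_zero mult_pos_pos order_less_le_trans)
    define x where "x = ln s - ln q"
    have "ln (q * exp (- Y)) \<le> ln s" "ln s \<le> ln (q * exp Y)"
      using q s assms by (auto intro!: iffD2[OF ln_le_cancel_iff])
    hence x: "\<bar>x\<bar> \<le> Y" using q by (simp add: x_def ln_mult abs_le_iff)
    have lnq: "ln q \<le> E" using q assms(3) by (metis ln_exp ln_le_cancel_iff exp_gt_zero)
    have pq: "of_real q powr m = exp (m * of_real (ln q))"
      and ps: "of_real s powr m = exp (m * of_real (ln s))"
      using q s by (auto simp: powr_def Ln_of_real)
    have "of_real s powr m = of_real q powr m * exp (m * of_real x)"
      unfolding pq ps exp_add[symmetric] x_def by (simp add: algebra_simps)
    hence "norm (of_real s powr m - of_real q powr m)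
        = norm (of_real q powr m) * norm (exp (m * of_real x) - 1)"
      by (simp add: norm_mult[symmetric] algebra_simps)
    also have "\<dots> \<le> exp (norm m * E) * (norm m * Y * exp (norm m * Y))"
    proof (intro mult_mono)
      have "norm (of_real q powr m) = exp (Re m * ln q)" unfolding pq by simp
      also have "Re m * ln q \<le> Re m * E" using lnq assms by (intro mult_left_mono)
      also have "\<dots> \<le> norm m * E" using assms complex_Re_le_cmod by (intro mult_right_mono)
      finally show "norm (of_real q powr m) \<le> exp (norm m * E)" by simp
      have "norm (exp (m * of_real x) - 1) \<le> exp (norm (m * of_real x)) * norm (m * of_real x)"
        using Taylor_exp_field[of "m * of_real x" 0] by simp
      also have "\<dots> \<le> exp (norm m * Y) * (norm m * Y)"
        using x Y by (intro mult_mono) (auto simp: norm_mult intro: mult_left_mono)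
      finally show "norm (exp (m * of_real x) - 1) \<le> norm m * Y * exp (norm m * Y)"
        by (simp add: mult_ac)
    qed auto
    also have "\<dots> = norm m * Y * exp (norm m * (E + Y))"
      by (simp add: exp_add algebra_simps)
    finally show ?thesis .
  qed
qed


text \<open>Pointwise the error is at most \<open>norm m * Y * U\<close>, where \<open>Y\<close> has
  mean square \<open>O(1 / Q)\<close> and \<open>U\<close> has bounded mean square. The
  arithmetic-geometric inequality weighted by \<open>sqrt Q\<close> balances the two. The constant
  is independent of \<open>h\<close>, which the later interchange of limits rests on.\<close>

lemma singular_series_truncation_error:
  assumes "k \<ge> 1" "Re m \<ge> 0"
  shows "\<exists>K. \<forall>h. \<forall>Q\<ge>2 * k.
    (\<Sum>hs\<in>distinct_tuples k h. norm (of_real (singular_series hs) powr m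
        - of_real (partial_series Q hs) powr m)) \<le> K * real h ^ k / sqrt (real Q)"
proof -
  define C where "C = 2 * real k ^ 2"
  \<comment> \<open>Chosen so that \<open>U hs ^ 2\<close> is a constant times
    \<open>exp (B * collision_sum 0 hs)\<close>.\<close>
  define B where "B = 4 * norm m * real k"
  \<comment> \<open>Here \<open>2 * C + real k * collision_sum 0 hs\<close> is the logarithmic bound
    \<open>E\<close> for the truncated series; it also dominates \<open>Y\<close>, hence the factor
    \<open>2\<close> for \<open>E + Y\<close>.\<close>
  define U where "U = (\<lambda>hs. exp (2 * norm m * (2 * C + real k * collision_sum 0 hs)))"
  define Y where "Y = (\<lambda>Q hs. C / real Q + real k * collision_sum Q hs)"
  have C: "C \<ge> 0" by (simp add: C_def)
  obtain K1 where K1: "\<And>h. (\<Sum>hs\<in>distinct_tuples k h. exp (B * collision_sum 0 hs)) \<le> K1 * real h ^ k"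
    using exp_collision_sum_moment[of k B] assms by (auto simp: B_def)
  obtain K2 where K2: "K2 \<ge> 0" "\<And>h Q. Q \<ge> 1 \<Longrightarrow>
      (\<Sum>hs\<in>distinct_tuples k h. collision_sum Q hs ^ 2) \<le> K2 * real h ^ k / real Q"
    using collision_sum_square_moment[OF assms(1)] by blast
  define K3 where "K3 = 2 * C ^ 2 + 2 * real k ^ 2 * K2"
  define K4 where "K4 = exp (8 * norm m * C) * K1"
  have pointwise: "norm (of_real (singular_series hs) powr m - of_real (partial_series Q hs) powr m)
      \<le> norm m * (Y Q hs * U hs)"
    if hs: "hs \<in> distinct_tuples k h" and Q: "Q \<ge> 2 * k" for hs h Q
  proof -
    have dist: "distinct hs" and len: "length hs = k" using hs by (auto simp: distinct_tuples_def)
    have Q1: "real Q \<ge> 1" using Q assms by simp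
    have pos: "0 \<le> partial_series Q hs" unfolding partial_series_def euler_term_def
      by (intro prod_nonneg) (auto simp: euler_factor_nonneg)
    \<comment> \<open>The index \<open>0\<close>, whose term is \<open>1\<close>, is removed because
      \<open>prod_euler_term_upper\<close> at level \<open>0\<close> asks for positive
      indices.\<close>
    have "{..Q} = insert 0 {1..Q}" by auto
    hence "partial_series Q hs = (\<Prod>n\<in>{1..Q}. euler_term hs n)"
      by (simp add: partial_series_def euler_term_def)
    also have "\<dots> \<le> exp (2 * real k ^ 2 * 2 + real k * collision_sum 0 hs)"
      using dist len assms(1) sum_inverse_squares_le by (intro prod_euler_term_upper) auto
    finally have upper: "partial_series Q hs \<le> exp (2 * C + real k * collision_sum 0 hs)"
      by (simp add: C_def mult_ac)
    have W: "0 \<le> real k * collision_sum Q hs" "real k * collision_sum Q hs \<le> real k * collision_sum 0 hs"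
      "0 \<le> real k * collision_sum 0 hs"
      using collision_sum_antimono[OF dist, of 0 Q]
      by (auto intro: mult_left_mono simp: collision_sum_nonneg)
    have CQ: "0 \<le> C / real Q" "C / real Q \<le> C"
      using C Q1 by (auto simp: divide_le_eq mult_le_cancel_left1)
    have Y0: "Y Q hs \<ge> 0" using CQ W by (simp add: Y_def)
    have low: "partial_series Q hs * exp (- Y Q hs) \<le> singular_series hs"
    proof -
      have "partial_series Q hs * exp (- Y Q hs)
          \<le> partial_series Q hs * exp (- (2 * real k ^ 2 * (1 / real Q)))"
        using pos W by (intro mult_left_mono) (auto simp: Y_def C_def)
      also have "\<dots> \<le> singular_series hs"
        by (rule singular_series_bounds[OF dist len assms(1) Q])
      finally show ?thesis .
    qed
    have up: "singular_series hs \<le> partial_series Q hs * exp (Y Q hs)"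
      using singular_series_bounds(1)[OF dist len assms(1) Q] by (simp add: Y_def C_def)
    have "norm (of_real (singular_series hs) powr m - of_real (partial_series Q hs) powr m)
      \<le> norm m * Y Q hs * exp (norm m * ((2 * C + real k * collision_sum 0 hs) + Y Q hs))"
      using assms(2) pos upper Y0 low up C W by (intro norm_powr_diff_le) auto
    also have "\<dots> \<le> norm m * Y Q hs * U hs"
    proof (intro mult_left_mono mult_nonneg_nonneg norm_ge_zero Y0)
      have "norm m * ((2 * C + real k * collision_sum 0 hs) + Y Q hs)
          \<le> norm m * (2 * (2 * C + real k * collision_sum 0 hs))"
        using CQ W C by (intro mult_left_mono) (auto simp: Y_def)
      thus "exp (norm m * ((2 * C + real k * collision_sum 0 hs) + Y Q hs)) \<le> U hs"
        by (simp add: U_def mult_ac)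
    qed
    finally show ?thesis by (simp add: mult.assoc)
  qed
  have Y_square: "(\<Sum>hs\<in>distinct_tuples k h. Y Q hs ^ 2) \<le> K3 * real h ^ k / real Q"
    if Q: "Q \<ge> 1" for Q h
  proof -
    have "(\<Sum>hs\<in>distinct_tuples k h. Y Q hs ^ 2)
        \<le> (\<Sum>hs\<in>distinct_tuples k h. 2 * C ^ 2 / real Q + 2 * real k ^ 2 * collision_sum Q hs ^ 2)"
    proof (rule sum_mono)
      fix hs
      have "(a + b) ^ 2 \<le> 2 * a ^ 2 + 2 * b ^ 2" for a b :: real
        using zero_le_power2[of "a - b"] by (simp add: power2_eq_square algebra_simps)
      from this[of "C / real Q" "real k * collision_sum Q hs"]
      have "Y Q hs ^ 2 \<le> 2 * (C / real Q) ^ 2 + 2 * (real k * collision_sum Q hs) ^ 2"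
        by (simp add: Y_def)
      moreover have "(C / real Q) ^ 2 \<le> C ^ 2 / real Q"
        using Q by (simp add: power2_eq_square divide_simps mult_le_cancel_left1)
      ultimately show "Y Q hs ^ 2 \<le> 2 * C ^ 2 / real Q + 2 * real k ^ 2 * collision_sum Q hs ^ 2"
        by (simp add: power_mult_distrib)
    qed
    also have "\<dots> = real (card (distinct_tuples k h)) * (2 * C ^ 2 / real Q)
        + 2 * real k ^ 2 * (\<Sum>hs\<in>distinct_tuples k h. collision_sum Q hs ^ 2)"
      by (simp add: sum.distrib sum_distrib_left)
    also have "\<dots> \<le> real h ^ k * (2 * C ^ 2 / real Q) + 2 * real k ^ 2 * (K2 * real h ^ k / real Q)"
    proof (intro add_mono mult_right_mono mult_left_mono K2 Q)
      show "real (card (distinct_tuples k h)) \<le> real h ^ k"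
        using card_distinct_tuples_le[of k h] by (metis of_nat_le_iff of_nat_power)
    qed auto
    also have "\<dots> = K3 * real h ^ k / real Q" by (simp add: K3_def algebra_simps add_divide_distrib)
    finally show ?thesis .
  qed
  have U_square: "(\<Sum>hs\<in>distinct_tuples k h. U hs ^ 2) \<le> K4 * real h ^ k" for h
  proof -
    have "U hs ^ 2 = exp (8 * norm m * C) * exp (B * collision_sum 0 hs)" for hs
      by (simp add: U_def B_def power2_eq_square exp_add[symmetric] algebra_simps)
    thus ?thesis using K1[of h] by (simp add: K4_def sum_distrib_left[symmetric] mult.assoc)
  qed
  show ?thesis
  proof (intro exI allI impI)
    fix h Q :: nat assume Q: "Q \<ge> 2 * k"
    define r where "r = sqrt (real Q)"
    have Q1: "Q \<ge> 1" using Q assms by simp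
    have r: "r > 0" "real Q = r * r" using Q1 by (auto simp: r_def)
    have "(\<Sum>hs\<in>distinct_tuples k h. norm (of_real (singular_series hs) powr m
        - of_real (partial_series Q hs) powr m))
      \<le> (\<Sum>hs\<in>distinct_tuples k h. norm m * (r * Y Q hs ^ 2 + U hs ^ 2 / r))"
    proof (rule sum_mono)
      fix hs assume hs: "hs \<in> distinct_tuples k h"
      \<comment> \<open>Expanded and halved, this is \<open>r * Y * U \<le> r^2 * Y^2 + U^2\<close>;
        division by \<open>r\<close> gives the weighted bound.\<close>
      have "0 \<le> (r * Y Q hs - U hs) ^ 2 + (r * Y Q hs) ^ 2 + U hs ^ 2" by simp
      hence "Y Q hs * U hs \<le> r * Y Q hs ^ 2 + U hs ^ 2 / r"
        using r(1) by (simp add: field_simps power2_eq_square)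
      hence "norm m * (Y Q hs * U hs) \<le> norm m * (r * Y Q hs ^ 2 + U hs ^ 2 / r)"
        by (intro mult_left_mono) auto
      thus "norm (of_real (singular_series hs) powr m - of_real (partial_series Q hs) powr m)
        \<le> norm m * (r * Y Q hs ^ 2 + U hs ^ 2 / r)"
        using pointwise[OF hs Q] by linarith
    qed
    also have "\<dots> = norm m * (r * (\<Sum>hs\<in>distinct_tuples k h. Y Q hs ^ 2)
        + (\<Sum>hs\<in>distinct_tuples k h. U hs ^ 2) / r)"
      by (simp add: sum_distrib_left[symmetric] sum.distrib sum_divide_distrib)
    also have "\<dots> \<le> norm m * (r * (K3 * real h ^ k / real Q) + K4 * real h ^ k / r)"
      using r(1) Q1 Y_square U_square
      by (intro mult_left_mono add_mono divide_right_mono) auto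
    also have "\<dots> = norm m * (K3 + K4) * real h ^ k / sqrt (real Q)"
      using r by (simp add: r_def[symmetric] field_simps)
    finally show "(\<Sum>hs\<in>distinct_tuples k h. norm (of_real (singular_series hs) powr m
        - of_real (partial_series Q hs) powr m)) \<le> norm m * (K3 + K4) * real h ^ k / sqrt (real Q)" .
  qed
qed

section \<open>Means of periodic functions of tuples\<close>

text \<open>The quotient by \<open>P\<close> is injective on a residue class, so the count differs
  from \<open>h / P\<close> by at most \<open>2\<close>.\<close>

lemma residue_class_density:
  assumes "r < P"
  shows "(\<lambda>h. real (card {a \<in> {1..h}. a mod P = r}) / real h) \<longlonglongrightarrow> 1 / real P"
proof -
  have P: "P > 0" using assms by simp
  have upper: "card {a \<in> {1..h}. a mod P = r} \<le> h div P + 1" for h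
  proof -
    have "inj_on (\<lambda>a. a div P) {a \<in> {1..h}. a mod P = r}"
      by (rule inj_onI) (metis (mono_tags, lifting) mem_Collect_eq mult_div_mod_eq)
    moreover have "(\<lambda>a. a div P) ` {a \<in> {1..h}. a mod P = r} \<subseteq> {..h div P}"
      by (auto simp: div_le_mono)
    ultimately show ?thesis using card_inj_on_le[of _ _ "{..h div P}"] by fastforce
  qed
  have lower: "h div P \<le> card {a \<in> {1..h}. a mod P = r} + 1" for h
  proof -
    \<comment> \<open>The quotient \<open>0\<close> is left out because \<open>r\<close> may be
      \<open>0\<close>, and the quotient \<open>h div P\<close> because its block may extend beyond
      \<open>h\<close>.\<close>
    have "inj_on (\<lambda>q. q * P + r) {1..<h div P}"
      using P by (auto simp: inj_on_def)
    moreover have "(\<lambda>q. q * P + r) ` {1..<h div P} \<subseteq> {a \<in> {1..h}. a mod P = r}"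
    proof clarify
      fix q assume q: "q \<in> {1..<h div P}"
      have "q * P + r \<le> (q + 1) * P" using assms by simp
      also have "\<dots> \<le> (h div P) * P" using q by (intro mult_right_mono) auto
      also have "\<dots> \<le> h" by simp
      finally show "q * P + r \<in> {1..h} \<and> (q * P + r) mod P = r"
        using q P assms by (auto simp: Suc_le_eq)
    qed
    ultimately have "card {1..<h div P} \<le> card {a \<in> {1..h}. a mod P = r}"
      by (intro card_inj_on_le) auto
    thus ?thesis by simp
  qed
  have bound: "\<bar>real (card {a \<in> {1..h}. a mod P = r}) / real h - 1 / real P\<bar> \<le> 2 / real h"
    if h: "h > 0" for h
  proof -
    have "real (h div P) \<le> real h / real P" by (rule of_nat_div_le_of_nat)
    moreover have "real h / real P < real (h div P) + 1"
    proof -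
      have "h < (h div P + 1) * P" using P by (metis Suc_eq_plus1 dividend_less_div_times mult.commute mult_Suc_right)
      hence "real h < real ((h div P + 1) * P)" by (simp only: of_nat_less_iff)
      thus ?thesis using P by (simp add: divide_less_eq algebra_simps)
    qed
    ultimately have "\<bar>real (card {a \<in> {1..h}. a mod P = r}) - real h / real P\<bar> \<le> 2"
      using upper[of h] lower[of h] by linarith
    moreover have "real (card {a \<in> {1..h}. a mod P = r}) / real h - 1 / real P
        = (real (card {a \<in> {1..h}. a mod P = r}) - real h / real P) / real h"
      using h P by (simp add: field_simps)
    ultimately show ?thesis using h by (simp add: divide_right_mono)
  qed
  have "(\<lambda>h. real (card {a \<in> {1..h}. a mod P = r}) / real h - 1 / real P) \<longlonglongrightarrow> 0"
  proof (rule Lim_null_comparison)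
    show "eventually (\<lambda>h. norm (real (card {a \<in> {1..h}. a mod P = r}) / real h - 1 / real P)
        \<le> 2 / real h) sequentially"
      using eventually_gt_at_top[of 0] by eventually_elim (use bound in simp)
    show "(\<lambda>h. 2 / real h) \<longlonglongrightarrow> 0" by (rule lim_const_over_n)
  qed
  thus ?thesis using LIM_zero_iff by blast
qed

lemma sum_lists_length_Suc:
  fixes g :: "'a list \<Rightarrow> 'b::comm_monoid_add"
  shows "(\<Sum>xs | set xs \<subseteq> A \<and> length xs = Suc k. g xs)
     = (\<Sum>x\<in>A. \<Sum>xs | set xs \<subseteq> A \<and> length xs = k. g (x # xs))"
proof -
  let ?L = "{xs. set xs \<subseteq> A \<and> length xs = k}"
  have "(\<Sum>xs | set xs \<subseteq> A \<and> length xs = Suc k. g xs) = (\<Sum>(xs, x)\<in>?L \<times> A. g (x # xs))"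
    unfolding lists_length_Suc_eq by (subst sum.reindex) (auto simp: inj_on_def case_prod_beta)
  also have "\<dots> = (\<Sum>xs\<in>?L. \<Sum>x\<in>A. g (x # xs))" by (rule sum.cartesian_product[symmetric])
  also have "\<dots> = (\<Sum>x\<in>A. \<Sum>xs\<in>?L. g (x # xs))" by (rule sum.swap)
  finally show ?thesis .
qed

text \<open>Induction on the length: the head is grouped by its residue \<open>r\<close>, each class
  has density \<open>1 / P\<close>, and the induction hypothesis for \<open>g (r # _)\<close>
  handles the tail.\<close>

lemma periodic_list_mean:
  fixes g :: "nat list \<Rightarrow> complex"
  assumes "P > 0" "\<And>xs. length xs = k \<Longrightarrow> g (map (\<lambda>a. a mod P) xs) = g xs"
  shows "(\<lambda>h. (\<Sum>xs | set xs \<subseteq> {1..h} \<and> length xs = k. g xs) / of_nat h ^ k)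
    \<longlonglongrightarrow> (\<Sum>xs | set xs \<subseteq> {..<P} \<and> length xs = k. g xs) / of_nat P ^ k"
  using assms(2)
proof (induction k arbitrary: g)
  case 0
  have "{xs. set xs \<subseteq> A \<and> length xs = 0} = {[]}" for A :: "nat set" by auto
  thus ?case by simp
next
  case (Suc k)
  let ?L = "\<lambda>A. {xs::nat list. set xs \<subseteq> A \<and> length xs = k}"
  \<comment> \<open>Both lists reduce to the same list modulo \<open>P\<close>, so periodicity in
    all entries at once yields periodicity in the head alone.\<close>
  have g_mod: "g (x # xs) = g (x mod P # xs)" if "length xs = k" for x xs
    using Suc.prems[of "x # xs"] Suc.prems[of "x mod P # xs"] that by simp
  have lim: "(\<lambda>h. (\<Sum>xs\<in>?L {1..h}. g (r # xs)) / of_nat h ^ k)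
    \<longlonglongrightarrow> (\<Sum>xs\<in>?L {..<P}. g (r # xs)) / of_nat P ^ k" if "r < P" for r
    using Suc.IH[of "\<lambda>xs. g (r # xs)"] Suc.prems[of "r # _"] that by simp
  have "(\<lambda>h. \<Sum>r<P. of_real (real (card {a \<in> {1..h}. a mod P = r}) / real h)
      * ((\<Sum>xs\<in>?L {1..h}. g (r # xs)) / of_nat h ^ k))
    \<longlonglongrightarrow> (\<Sum>r<P. of_real (1 / real P) * ((\<Sum>xs\<in>?L {..<P}. g (r # xs)) / of_nat P ^ k))"
    by (intro tendsto_sum tendsto_mult tendsto_of_real residue_class_density lim) auto
  also have "(\<Sum>r<P. of_real (1 / real P) * ((\<Sum>xs\<in>?L {..<P}. g (r # xs)) / of_nat P ^ k))
      = (\<Sum>xs | set xs \<subseteq> {..<P} \<and> length xs = Suc k. g xs) / of_nat P ^ Suc k"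
    by (simp add: sum_lists_length_Suc sum_divide_distrib mult.commute)
  also have "(\<lambda>h. \<Sum>r<P. of_real (real (card {a \<in> {1..h}. a mod P = r}) / real h)
      * ((\<Sum>xs\<in>?L {1..h}. g (r # xs)) / of_nat h ^ k))
    = (\<lambda>h. (\<Sum>xs | set xs \<subseteq> {1..h} \<and> length xs = Suc k. g xs) / of_nat h ^ Suc k)"
  proof
    fix h
    have "(\<Sum>xs | set xs \<subseteq> {1..h} \<and> length xs = Suc k. g xs)
        = (\<Sum>x\<in>{1..h}. \<Sum>xs\<in>?L {1..h}. g (x mod P # xs))"
      unfolding sum_lists_length_Suc by (intro sum.cong refl g_mod) auto
    also have "\<dots> = (\<Sum>r<P. \<Sum>x\<in>{a \<in> {1..h}. a mod P = r}. \<Sum>xs\<in>?L {1..h}. g (x mod P # xs))"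
      using assms(1) by (intro sum.group[symmetric]) auto
    also have "\<dots> = (\<Sum>r<P. of_nat (card {a \<in> {1..h}. a mod P = r}) * (\<Sum>xs\<in>?L {1..h}. g (r # xs)))"
      by (intro sum.cong refl) simp
    finally show "(\<Sum>r<P. of_real (real (card {a \<in> {1..h}. a mod P = r}) / real h)
        * ((\<Sum>xs\<in>?L {1..h}. g (r # xs)) / of_nat h ^ k))
      = (\<Sum>xs | set xs \<subseteq> {1..h} \<and> length xs = Suc k. g xs) / of_nat h ^ Suc k"
      by (simp add: sum_divide_distrib[where A = "{..<P}"])
  qed
  finally show ?case .
qed

text \<open>The count is a falling factorial with \<open>k\<close> factors, each between
  \<open>h - k\<close> and \<open>h\<close>.\<close>

lemma card_distinct_tuples_asymp:
  "(\<lambda>h. real (card (distinct_tuples k h)) / real h ^ k) \<longlonglongrightarrow> 1"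
proof (rule tendsto_sandwich)
  show "eventually (\<lambda>h. (1 - real k / real h) ^ k \<le> real (card (distinct_tuples k h)) / real h ^ k) sequentially"
    using eventually_gt_at_top[of k]
  proof eventually_elim
    fix h assume h: "k < h"
    have "(h - k) ^ k \<le> \<Prod>{h - k + 1..h}"
      using prod_mono[of "{h - k + 1..h}" "\<lambda>_. h - k" "\<lambda>i. i"] h by simp
    also have "\<dots> = card (distinct_tuples k h)"
      using card_lists_distinct_length_eq[of "{1..h}" k] h by (simp add: distinct_tuples_def)
    finally have "real ((h - k) ^ k) \<le> real (card (distinct_tuples k h))"
      by (rule of_nat_mono)
    hence "(real h - real k) ^ k \<le> real (card (distinct_tuples k h))"
      using h by (simp add: of_nat_diff)
    moreover have "(1 - real k / real h) ^ k = (real h - real k) ^ k / real h ^ k"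
      using h by (simp add: power_divide[symmetric] diff_divide_distrib)
    ultimately show "(1 - real k / real h) ^ k \<le> real (card (distinct_tuples k h)) / real h ^ k"
      by (simp add: divide_right_mono)
  qed
  show "eventually (\<lambda>h. real (card (distinct_tuples k h)) / real h ^ k \<le> 1) sequentially"
    using eventually_gt_at_top[of 0]
  proof eventually_elim
    fix h :: nat assume "h > 0"
    moreover have "real (card (distinct_tuples k h)) \<le> real h ^ k"
      using card_distinct_tuples_le[of k h] by (metis of_nat_le_iff of_nat_power)
    ultimately show "real (card (distinct_tuples k h)) / real h ^ k \<le> 1" by simp
  qed
  have "(\<lambda>h. (1 - real k / real h) ^ k) \<longlonglongrightarrow> (1 - 0) ^ k"
    by (intro tendsto_intros lim_const_over_n)
  thus "(\<lambda>h. (1 - real k / real h) ^ k) \<longlonglongrightarrow> 1" by simp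
qed simp

text \<open>A periodic function is bounded, and lists with a repeated entry have density
  \<open>0\<close>, so the mean over all lists is unchanged.\<close>

lemma periodic_distinct_mean:
  fixes g :: "nat list \<Rightarrow> complex"
  assumes "P > 0" "\<And>xs. length xs = k \<Longrightarrow> g (map (\<lambda>a. a mod P) xs) = g xs"
  shows "(\<lambda>h. (\<Sum>xs\<in>distinct_tuples k h. g xs) / of_nat h ^ k)
    \<longlonglongrightarrow> (\<Sum>xs | set xs \<subseteq> {..<P} \<and> length xs = k. g xs) / of_nat P ^ k"
proof -
  let ?L = "\<lambda>A. {xs::nat list. set xs \<subseteq> A \<and> length xs = k}"
  define B where "B = (\<Sum>xs\<in>?L {..<P}. norm (g xs))"
  have B: "norm (g xs) \<le> B" if "length xs = k" for xs
  proof -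
    have "map (\<lambda>a. a mod P) xs \<in> ?L {..<P}" using that assms(1) by auto
    hence "norm (g (map (\<lambda>a. a mod P) xs)) \<le> B"
      unfolding B_def by (intro member_le_sum finite_lists_length_eq) auto
    thus ?thesis using assms(2)[OF that] by simp
  qed
  have diff: "(\<lambda>h. (\<Sum>xs\<in>?L {1..h}. g xs) / of_nat h ^ k - (\<Sum>xs\<in>distinct_tuples k h. g xs) / of_nat h ^ k)
      \<longlonglongrightarrow> 0"
  proof (rule Lim_null_comparison)
    have "(\<lambda>h. B * (1 - real (card (distinct_tuples k h)) / real h ^ k)) \<longlonglongrightarrow> B * (1 - 1)"
      by (intro tendsto_intros card_distinct_tuples_asymp)
    thus "(\<lambda>h. B * (1 - real (card (distinct_tuples k h)) / real h ^ k)) \<longlonglongrightarrow> 0" by simp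
    show "eventually (\<lambda>h. norm ((\<Sum>xs\<in>?L {1..h}. g xs) / of_nat h ^ k
        - (\<Sum>xs\<in>distinct_tuples k h. g xs) / of_nat h ^ k)
      \<le> B * (1 - real (card (distinct_tuples k h)) / real h ^ k)) sequentially"
      using eventually_gt_at_top[of 0]
    proof eventually_elim
      fix h :: nat assume h: "h > 0"
      have sub: "distinct_tuples k h \<subseteq> ?L {1..h}" by (auto simp: distinct_tuples_def)
      have fin: "finite (?L {1..h})" by (rule finite_lists_length_eq) simp
      have "norm ((\<Sum>xs\<in>?L {1..h}. g xs) - (\<Sum>xs\<in>distinct_tuples k h. g xs))
          = norm (\<Sum>xs\<in>?L {1..h} - distinct_tuples k h. g xs)"
        by (simp only: sum_diff[OF fin sub])
      also have "\<dots> \<le> (\<Sum>xs\<in>?L {1..h} - distinct_tuples k h. B)"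
        by (rule sum_norm_le) (use B in auto)
      also have "\<dots> = B * real (card (?L {1..h} - distinct_tuples k h))" by simp
      also have "card (?L {1..h} - distinct_tuples k h) = h ^ k - card (distinct_tuples k h)"
        using card_Diff_subset[OF finite_distinct_tuples sub] by (simp add: card_lists_length_eq)
      finally have "norm ((\<Sum>xs\<in>?L {1..h}. g xs) - (\<Sum>xs\<in>distinct_tuples k h. g xs))
          \<le> B * (real h ^ k - real (card (distinct_tuples k h)))"
        using card_distinct_tuples_le[of k h] by (simp add: of_nat_diff)
      hence "norm ((\<Sum>xs\<in>?L {1..h}. g xs) - (\<Sum>xs\<in>distinct_tuples k h. g xs)) / real h ^ k
          \<le> B * (real h ^ k - real (card (distinct_tuples k h))) / real h ^ k"
        by (intro divide_right_mono) auto
      thus "norm ((\<Sum>xs\<in>?L {1..h}. g xs) / of_nat h ^ k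
          - (\<Sum>xs\<in>distinct_tuples k h. g xs) / of_nat h ^ k)
        \<le> B * (1 - real (card (distinct_tuples k h)) / real h ^ k)"
        using h by (simp add: diff_divide_distrib[symmetric] norm_divide norm_power field_simps)
    qed
  qed
  show ?thesis
    using tendsto_diff[OF periodic_list_mean[of P k g, OF assms] diff] by simp
qed

section \<open>Local means and their symmetry\<close>

text \<open>Chinese remainder theorem; it supplies the independence of conditions modulo distinct
  primes.\<close>

lemma card_coprime_residues:
  fixes q n :: nat
  assumes "coprime q n" "q > 0" "n > 0"
  shows "card {b. b < q * n \<and> G (b mod q) \<and> H (b mod n)} = card {r. r < q \<and> G r} * card {b. b < n \<and> H b}"
proof -
  have "bij_betw (\<lambda>b. (b mod q, b mod n)) {b. b < q * n \<and> G (b mod q) \<and> H (b mod n)}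
      ({r. r < q \<and> G r} \<times> {b. b < n \<and> H b})"
  proof (rule bij_betwI')
    fix b c assume "b \<in> {b. b < q * n \<and> G (b mod q) \<and> H (b mod n)}"
      "c \<in> {b. b < q * n \<and> G (b mod q) \<and> H (b mod n)}"
    hence less: "b < q * n" "c < q * n" by auto
    have "b = c" if "b mod q = c mod q" "b mod n = c mod n"
    proof -
      have "[b = c] (mod q * n)"
        using that assms(1) by (intro coprime_cong_mult_nat) (simp_all only: cong_def)
      thus ?thesis using less by (rule cong_less_modulus_unique_nat)
    qed
    thus "((b mod q, b mod n) = (c mod q, c mod n)) = (b = c)" by blast
  next
    fix b assume "b \<in> {b. b < q * n \<and> G (b mod q) \<and> H (b mod n)}"
    thus "(b mod q, b mod n) \<in> {r. r < q \<and> G r} \<times> {b. b < n \<and> H b}"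
      using assms by auto
  next
    fix t assume t: "t \<in> {r. r < q \<and> G r} \<times> {b. b < n \<and> H b}"
    have "q \<noteq> 0" "n \<noteq> 0" using assms by auto
    from binary_chinese_remainder_unique_nat[OF assms(1) this, of "fst t" "snd t"]
    obtain x where x: "x < q * n" "[x = fst t] (mod q)" "[x = snd t] (mod n)" by blast
    hence "x mod q = fst t" "x mod n = snd t" using t by (auto simp: cong_def)
    thus "\<exists>b\<in>{b. b < q * n \<and> G (b mod q) \<and> H (b mod n)}. t = (b mod q, b mod n)"
      using t x(1) by (intro bexI[of _ x]) auto
  qed
  thus ?thesis by (simp add: bij_betw_same_card card_cartesian_product)
qed

lemma card_residues_prod_primes:
  assumes "finite A" "\<And>p. p \<in> A \<Longrightarrow> prime (p::nat)"
  shows "card {b. b < \<Prod>A \<and> (\<forall>p\<in>A. G p (b mod p))} = (\<Prod>p\<in>A. card {r. r < p \<and> G p r})"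
  using assms
proof (induction A rule: finite_induct)
  case empty
  have "{b::nat. b < \<Prod>{} \<and> (\<forall>p\<in>{}. G p (b mod p))} = {0}" by auto
  thus ?case by simp
next
  case (insert q A)
  have coprime: "coprime q (\<Prod>A)"
    using insert by (intro prod_coprime_right primes_coprime) auto
  have pos: "q > 0" "\<Prod>A > 0"
    using insert by (auto intro!: prod_pos prime_gt_0_nat)
  \<comment> \<open>The conditions at the primes in \<open>A\<close> become a single condition on
    \<open>b mod \<Prod>A\<close>, as the lemma for two moduli requires.\<close>
  have mod_mod: "b mod \<Prod>A mod p = b mod p" if "p \<in> A" for b p
    using that insert by (intro mod_mod_cancel dvd_prodI) auto
  have "{b. b < \<Prod>(insert q A) \<and> (\<forall>p\<in>insert q A. G p (b mod p))}
      = {b. b < q * \<Prod>A \<and> G q (b mod q) \<and> (\<forall>p\<in>A. G p (b mod \<Prod>A mod p))}"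
    using insert mod_mod by auto
  thus ?case
    using card_coprime_residues[OF coprime pos, of "G q" "\<lambda>b. \<forall>p\<in>A. G p (b mod p)"] insert
    by simp
qed

section \<open>The truncated series modulo the primorial\<close>

definition primes_upto :: "nat \<Rightarrow> nat set" where
  "primes_upto Q = {p. prime p \<and> p \<le> Q}"

definition primorial :: "nat \<Rightarrow> nat" where
  "primorial Q = \<Prod>(primes_upto Q)"

definition residue_lists :: "nat \<Rightarrow> nat \<Rightarrow> nat list set" where
  "residue_lists Q k = {xs. set xs \<subseteq> {..<primorial Q} \<and> length xs = k}"

definition local_mean :: "nat \<Rightarrow> nat \<Rightarrow> complex \<Rightarrow> complex" where
  "local_mean Q k m =
     (\<Sum>xs\<in>residue_lists Q k. of_real (partial_series Q xs) powr m) / of_nat (primorial Q) ^ k"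

definition avoids :: "nat \<Rightarrow> nat list \<Rightarrow> nat \<Rightarrow> bool" where
  "avoids Q xs b \<longleftrightarrow> (\<forall>p\<in>primes_upto Q. \<forall>a\<in>set xs. b mod p \<noteq> a mod p)"

lemma finite_primes_upto: "finite (primes_upto Q)"
  by (simp add: primes_upto_def)

lemma primorial_pos: "primorial Q > 0"
  unfolding primorial_def by (intro prod_pos) (auto simp: primes_upto_def prime_gt_0_nat)

lemma partial_series_eq_prod: "partial_series Q hs = (\<Prod>p\<in>primes_upto Q. euler_factor hs p)"
proof -
  have eq: "primes_upto Q = {n \<in> {..Q}. prime n}" by (auto simp: primes_upto_def)
  show ?thesis unfolding partial_series_def euler_term_def eq
    by (rule prod.inter_filter[symmetric]) simp
qed

lemma partial_series_mod: "partial_series Q (map (\<lambda>a. a mod primorial Q) hs) = partial_series Q hs"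
proof -
  have "residue_count p (map (\<lambda>a. a mod primorial Q) hs) = residue_count p hs"
    if "p \<in> primes_upto Q" for p
  proof -
    have "p dvd primorial Q" unfolding primorial_def
      using that finite_primes_upto by (intro dvd_prodI)
    thus ?thesis by (simp add: residue_count_def image_image mod_mod_cancel)
  qed
  thus ?thesis by (simp add: partial_series_eq_prod euler_factor_def)
qed

lemma local_mean_limit:
  "(\<lambda>h. (\<Sum>hs\<in>distinct_tuples k h. of_real (partial_series Q hs) powr m) / of_nat h ^ k)
    \<longlonglongrightarrow> local_mean Q k m"
  unfolding local_mean_def residue_lists_def
  by (rule periodic_distinct_mean) (simp_all add: primorial_pos partial_series_mod)

text \<open>Modulo \<open>p\<close> there are \<open>p - \<nu>\<close> residues outside the tuple,
  and the Chinese remainder theorem multiplies these counts. An \<open>m\<close>-th power of the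
  truncated series thereby counts \<open>m\<close>-tuples of avoiding residues.\<close>

lemma partial_series_eq_card:
  "partial_series Q hs = real (card {b. b < primorial Q \<and> avoids Q hs b}) / real (primorial Q)
     / (\<Prod>p\<in>primes_upto Q. 1 - 1 / real p) ^ length hs"
proof -
  have count: "real (card {r. r < p \<and> (\<forall>a\<in>set hs. r \<noteq> a mod p)}) = real p - real (residue_count p hs)"
    if "p \<in> primes_upto Q" for p
  proof -
    have p: "p > 0" using that by (simp add: primes_upto_def prime_gt_0_nat)
    have "{r. r < p \<and> (\<forall>a\<in>set hs. r \<noteq> a mod p)} = {..<p} - (\<lambda>a. a mod p) ` set hs" by auto
    moreover have "card ({..<p} - (\<lambda>a. a mod p) ` set hs) = p - residue_count p hs"
      unfolding residue_count_def using p by (subst card_Diff_subset) auto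
    ultimately show ?thesis using residue_count_le[OF p] by (simp add: of_nat_diff)
  qed
  have "real (card {b. b < primorial Q \<and> avoids Q hs b}) / real (primorial Q)
      = (\<Prod>p\<in>primes_upto Q. real (card {r. r < p \<and> (\<forall>a\<in>set hs. r \<noteq> a mod p)})) / (\<Prod>p\<in>primes_upto Q. real p)"
    unfolding primorial_def avoids_def
    using card_residues_prod_primes[OF finite_primes_upto, of Q "\<lambda>p r. \<forall>a\<in>set hs. r \<noteq> a mod p"]
    by (simp add: primes_upto_def)
  also have "\<dots> = (\<Prod>p\<in>primes_upto Q. (real p - real (residue_count p hs)) / real p)"
    unfolding prod_dividef[symmetric] by (intro prod.cong refl) (simp add: count)
  also have "\<dots> = (\<Prod>p\<in>primes_upto Q. 1 - real (residue_count p hs) / real p)"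
    by (intro prod.cong refl) (auto simp: primes_upto_def diff_divide_distrib dest: prime_gt_0_nat)
  finally show ?thesis
    by (simp add: partial_series_eq_prod euler_factor_def prod.distrib power_int_minus divide_inverse
        prod_inversef[symmetric] prod_power_distrib power_inverse)
qed

lemma avoids_sym: "(\<forall>b\<in>set ys. avoids Q xs b) \<longleftrightarrow> (\<forall>a\<in>set xs. avoids Q ys a)"
  unfolding avoids_def by metis

text \<open>Up to a power of \<open>\<Prod>(1 - 1 / p)\<close>, the local mean is the probability that, for two independent
  random tuples of lengths \<open>k\<close> and \<open>m\<close>, no entry of the first is congruent to an entry of the second
  modulo any \<open>p \<le> Q\<close>.\<close>

lemma local_mean_eq_double_count:
  assumes "m \<ge> 1"
  shows "local_mean Q k (of_nat m) = of_real
    ((\<Sum>xs\<in>residue_lists Q k. \<Sum>ys\<in>residue_lists Q m. if \<forall>b\<in>set ys. avoids Q xs b then 1 else 0)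
      / (real (primorial Q) ^ k * real (primorial Q) ^ m * (\<Prod>p\<in>primes_upto Q. 1 - 1 / real p) ^ (k * m)))"
proof -
  define c where "c = (\<Prod>p\<in>primes_upto Q. 1 - 1 / real p)"
  have "complex_of_real (partial_series Q xs) powr of_nat m = of_real
      ((\<Sum>ys\<in>residue_lists Q m. if \<forall>b\<in>set ys. avoids Q xs b then 1 else 0)
        / (real (primorial Q) ^ m * c ^ (k * m)))"
    if xs: "xs \<in> residue_lists Q k" for xs
  proof -
    let ?S = "{b. b < primorial Q \<and> avoids Q xs b}"
    have len: "length xs = k" using xs by (simp add: residue_lists_def)
    have "(\<Sum>ys\<in>residue_lists Q m. if \<forall>b\<in>set ys. avoids Q xs b then 1 else 0)
        = real (card {ys \<in> residue_lists Q m. \<forall>b\<in>set ys. avoids Q xs b})"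
      by (subst sum.inter_filter[symmetric])
         (auto simp: residue_lists_def finite_lists_length_eq)
    \<comment> \<open>The entries of \<open>ys\<close> are chosen independently from
      \<open>?S\<close>.\<close>
    also have "{ys \<in> residue_lists Q m. \<forall>b\<in>set ys. avoids Q xs b} = {ys. set ys \<subseteq> ?S \<and> length ys = m}"
      by (auto simp: residue_lists_def)
    also have "real (card \<dots>) = real (card ?S) ^ m"
      by (subst card_lists_length_eq) auto
    finally have count: "(\<Sum>ys\<in>residue_lists Q m. if \<forall>b\<in>set ys. avoids Q xs b then 1 else 0)
        = real (card ?S) ^ m" .
    \<comment> \<open>Here \<open>m \<ge> 1\<close> matters: the truncated series may vanish, and
      \<open>0 powr 0 = 0\<close> while \<open>0 ^ 0 = 1\<close>.\<close>
    have "complex_of_real (partial_series Q xs) powr of_nat m = of_real (partial_series Q xs ^ m)"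
      using assms by (simp add: powr_nat')
    also have "partial_series Q xs ^ m = real (card ?S) ^ m / (real (primorial Q) ^ m * c ^ (k * m))"
      unfolding partial_series_eq_card c_def len
      by (simp add: power_divide power_mult power_mult_distrib)
    finally show ?thesis unfolding count .
  qed
  hence "local_mean Q k (of_nat m) = (\<Sum>xs\<in>residue_lists Q k. of_real
      ((\<Sum>ys\<in>residue_lists Q m. if \<forall>b\<in>set ys. avoids Q xs b then 1 else 0)
        / (real (primorial Q) ^ m * c ^ (k * m)))) / of_nat (primorial Q) ^ k"
    unfolding local_mean_def by (intro arg_cong2[where f = "(/)"] sum.cong refl) blast
  also have "\<dots> = of_real ((\<Sum>xs\<in>residue_lists Q k.
      (\<Sum>ys\<in>residue_lists Q m. if \<forall>b\<in>set ys. avoids Q xs b then 1 else 0)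
        / (real (primorial Q) ^ m * c ^ (k * m))) / real (primorial Q) ^ k)"
    by (simp only: of_real_divide of_real_sum of_real_power of_real_of_nat_eq)
  also have "\<dots> = of_real
    ((\<Sum>xs\<in>residue_lists Q k. \<Sum>ys\<in>residue_lists Q m. if \<forall>b\<in>set ys. avoids Q xs b then 1 else 0)
      / (real (primorial Q) ^ k * real (primorial Q) ^ m * c ^ (k * m)))"
    unfolding sum_divide_distrib[symmetric] by (simp only: divide_divide_eq_left mult_ac)
  finally show ?thesis unfolding c_def .
qed

text \<open>Incongruence is a symmetric relation, so exchanging the two sums of the double count
  exchanges \<open>k\<close> and \<open>m\<close>.\<close>

lemma local_mean_sym:
  assumes "k \<ge> 1" "m \<ge> 1"
  shows "local_mean Q k (of_nat m) = local_mean Q m (of_nat k)"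
  unfolding local_mean_eq_double_count[OF assms(1)] local_mean_eq_double_count[OF assms(2)]
  by (subst sum.swap) (simp only: avoids_sym mult_ac)

section \<open>Interchange of the limits in \<open>h\<close> and \<open>Q\<close>\<close>

lemma singular_series_mean_eq:
  "singular_series_mean k m h
     = (\<Sum>hs\<in>distinct_tuples k h. of_real (singular_series hs) powr m) / of_nat h ^ k"
  by (simp add: singular_series_mean_def)

text \<open>The truncated means converge as \<open>h\<close> grows for fixed \<open>Q\<close>, and
  as \<open>Q\<close> grows uniformly in \<open>h > 0\<close>. The second conclusion identifies the
  limit with that of the local means, through which symmetry is inherited.\<close>

lemma singular_series_mean_limit:
  assumes "k \<ge> 1" "Re m \<ge> 0"
  obtains l where "singular_series_mean k m \<longlonglongrightarrow> l" "(\<lambda>Q. local_mean Q k m) \<longlonglongrightarrow> l"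
proof -
  define b where "b = (\<lambda>Q h. (\<Sum>hs\<in>distinct_tuples k h. complex_of_real (partial_series Q hs) powr m) / of_nat h ^ k)"
  obtain K where K: "\<And>h Q. Q \<ge> 2 * k \<Longrightarrow>
    (\<Sum>hs\<in>distinct_tuples k h. norm (of_real (singular_series hs) powr m
        - of_real (partial_series Q hs) powr m)) \<le> K * real h ^ k / sqrt (real Q)"
    using singular_series_truncation_error[OF assms] by blast
  have near: "norm (b Q h - singular_series_mean k m h) \<le> K / sqrt (real Q)"
    if "Q \<ge> 2 * k" "h > 0" for Q h
  proof -
    have "norm (b Q h - singular_series_mean k m h)
        = norm (\<Sum>hs\<in>distinct_tuples k h. of_real (singular_series hs) powr m
            - of_real (partial_series Q hs) powr m) / real h ^ k"
      unfolding b_def singular_series_mean_eq sum_subtractf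
      by (simp add: diff_divide_distrib[symmetric] norm_divide norm_power norm_minus_commute)
    also have "\<dots> \<le> (K * real h ^ k / sqrt (real Q)) / real h ^ k"
      using order_trans[OF norm_sum K[OF that(1)]] by (intro divide_right_mono) auto
    also have "\<dots> = K / sqrt (real Q)" using that by simp
    finally show ?thesis .
  qed
  have b_lim: "b Q \<longlonglongrightarrow> local_mean Q k m" for Q
    unfolding b_def by (rule local_mean_limit)
  have err: "(\<lambda>Q. K / sqrt (real Q)) \<longlonglongrightarrow> 0"
    by (intro tendsto_divide_0[OF tendsto_const] filterlim_at_top_imp_at_infinity
        filterlim_compose[OF sqrt_at_top filterlim_real_sequentially])
  \<comment> \<open>Only \<open>h > 0\<close> is included, as \<open>near\<close> cancels
    \<open>real h ^ k\<close>.\<close>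
  have unif: "uniform_limit {0<..} b (singular_series_mean k m) sequentially"
  proof (rule uniform_limitI)
    fix e :: real assume "e > 0"
    with err have "eventually (\<lambda>Q. K / sqrt (real Q) < e) sequentially"
      by (rule order_tendstoD)
    thus "\<forall>\<^sub>F Q in sequentially. \<forall>h\<in>{0<..}. dist (b Q h) (singular_series_mean k m h) < e"
      using eventually_ge_at_top[of "2 * k"]
    proof eventually_elim
      case (elim Q)
      show ?case
      proof
        fix h :: nat assume "h \<in> {0<..}"
        thus "dist (b Q h) (singular_series_mean k m h) < e"
          using near[of Q h] elim by (simp add: dist_norm)
      qed
    qed
  qed
  \<comment> \<open>Two truncations at the same \<open>h\<close> are both close to
    \<open>singular_series_mean k m h\<close>, hence to each other; letting \<open>h\<close> grow
    transfers this to the local means.\<close>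
  have "Cauchy (\<lambda>Q. local_mean Q k m)"
  proof (rule metric_CauchyI)
    fix e :: real assume e: "e > 0"
    hence "eventually (\<lambda>Q. K / sqrt (real Q) < e / 4) sequentially"
      using err by (intro order_tendstoD) auto
    then obtain N where N: "\<And>Q. Q \<ge> N \<Longrightarrow> K / sqrt (real Q) < e / 4"
      by (auto simp: eventually_sequentially)
    have "dist (local_mean Q k m) (local_mean R k m) < e"
      if "Q \<ge> N + 2 * k" "R \<ge> N + 2 * k" for Q R
    proof -
      have "dist (local_mean Q k m) (local_mean R k m) \<le> e / 2"
      proof (rule tendsto_upperbound)
        show "(\<lambda>h. dist (b Q h) (b R h)) \<longlonglongrightarrow> dist (local_mean Q k m) (local_mean R k m)"
          by (intro tendsto_dist b_lim)
        show "eventually (\<lambda>h. dist (b Q h) (b R h) \<le> e / 2) sequentially"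
          using eventually_gt_at_top[of 0]
        proof eventually_elim
          fix h :: nat assume "h > 0"
          hence "dist (b Q h) (singular_series_mean k m h) < e / 4"
            "dist (b R h) (singular_series_mean k m h) < e / 4"
            using le_less_trans[OF near[of Q h] N[of Q]] le_less_trans[OF near[of R h] N[of R]] that
            by (simp_all add: dist_norm)
          thus "dist (b Q h) (b R h) \<le> e / 2"
            using dist_triangle2[of "b Q h" "b R h" "singular_series_mean k m h"] by linarith
        qed
      qed simp
      thus ?thesis using e by linarith
    qed
    thus "\<exists>M. \<forall>Q\<ge>M. \<forall>R\<ge>M. dist (local_mean Q k m) (local_mean R k m) < e" by blast
  qed
  then obtain l where l: "(\<lambda>Q. local_mean Q k m) \<longlonglongrightarrow> l"
    using Cauchy_convergent_iff convergent_def by blast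
  have "singular_series_mean k m \<longlonglongrightarrow> l"
    by (rule swap_uniform_limit'[OF _ l unif]) (auto intro: b_lim always_eventually eventually_gt_at_top)
  thus ?thesis using l that by blast
qed

text \<open>A single entry occupies exactly one residue class, so each factor is
  \<open>(1 - 1 / p)\<close> times its inverse.\<close>

lemma singular_series_singleton:
  assumes "length hs = 1"
  shows "singular_series hs = 1"
proof -
  obtain a where a: "hs = [a]" using assms by (auto simp: length_Suc_conv)
  have "euler_factor hs p = 1" if "prime p" for p
    using prime_gt_1_nat[OF that] by (simp add: a euler_factor_def residue_count_def power_int_minus)
  hence "(\<lambda>p. if prime p then euler_factor hs p else 1) = (\<lambda>_. 1)" by auto
  thus ?thesis by (simp add: singular_series_def)
qed

lemma singular_series_mean_1_limit: "singular_series_mean 1 m \<longlonglongrightarrow> 1"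
proof -
  have "singular_series_mean 1 m = (\<lambda>h. of_real (real (card (distinct_tuples 1 h)) / real h ^ 1))"
    using singular_series_singleton
    by (intro ext) (simp add: singular_series_mean_eq distinct_tuples_def)
  thus ?thesis
    using tendsto_of_real[OF card_distinct_tuples_asymp[of 1], where 'a = complex] by simp
qed

theorem theorem1p1:
  "\<exists>\<mu> :: nat \<Rightarrow> complex \<Rightarrow> complex.
     (\<forall>k\<ge>1. \<forall>m. Re m \<ge> 0 \<longrightarrow> singular_series_mean k m \<longlonglongrightarrow> \<mu> k m) \<and>
     (\<forall>k\<ge>1. \<forall>m\<ge>1. \<mu> k (of_nat m) = \<mu> m (of_nat k)) \<and>
     (\<forall>m\<ge>1. \<mu> 1 (of_nat m) = 1) \<and>
     (\<forall>k\<ge>1. \<mu> k 1 = 1)"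
proof -
  \<comment> \<open>Since \<open>lim\<close> is total, this defines one function for all arguments;
    it is the actual limit wherever the mean converges.\<close>
  define \<mu> where "\<mu> = (\<lambda>k m. lim (singular_series_mean k m))"
  have \<mu>: "singular_series_mean k m \<longlonglongrightarrow> \<mu> k m" "(\<lambda>Q. local_mean Q k m) \<longlonglongrightarrow> \<mu> k m"
    if "k \<ge> 1" "Re m \<ge> 0" for k m
    using singular_series_mean_limit[OF that] unfolding \<mu>_def by (metis limI)+
  have sym: "\<mu> k (of_nat m) = \<mu> m (of_nat k)" if "k \<ge> 1" "m \<ge> 1" for k m
    using \<mu>(2)[of k "of_nat m"] \<mu>(2)[of m "of_nat k"] that
    by (simp add: local_mean_sym[OF that] LIMSEQ_unique)
  have one: "\<mu> 1 m = 1" for m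
    unfolding \<mu>_def by (rule limI[OF singular_series_mean_1_limit])
  have "\<mu> k 1 = 1" if "k \<ge> 1" for k
    using sym[of k 1] one that by simp
  thus ?thesis using \<mu>(1) sym one by blast
qed

end
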